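(* Let $\lambda$ and $\lambda'$ be partitions with at most $n$ parts, let $\beta\in U_\lambda(n)$ and let $\pi$ be a $\lambda'$-permutation. Suppose $s_\lambda(\beta;x)=d_{\lambda'}(\pi;x)$ as polynomials in $x_1,\dots,x_n$. Then $Q_\lambda(\beta)=Y_{\lambda'}(\pi)$. Hence $\lambda=\lambda'$ and $\Delta_\lambda(\beta)=\Psi_\lambda(\pi)$. Moreover $\pi$ is $\lambda$-312-avoiding and $\Delta_\lambda(\beta)$ is a gapless $\lambda$-tuple (so $\beta\in UGC_\lambda(n)$); in particular the only row bound sums that equal Demazure polynomials are flag Schur polynomials. Furthermore $\mathcal{S}_\lambda(\beta)=\mathcal{D}_\lambda(\pi)$ (i.e. $s_\lambda(\beta;x)\equiv d_{\lambda'}(\pi;x)$), and $\mathcal{S}_\lambda(\beta)=\mathcal{S}_\lambda(\Phi_\lambda[\Delta_\lambda(\beta)])$ where $\Phi_\lambda[\Delta_\lambda(\beta)]$ is an upper flag.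
   Context: Fix $n\ge1$; $[m]=\{1,\dots,m\}$, $(a,b]=\{a+1,\dots,b\}$; $\mathrm{rank}^d(Q)$ = $d$-th largest element of a finite $Q\subset\mathbb{Z}$. Partition $\lambda=(\lambda_1\ge\cdots\ge\lambda_n\ge0)$; boxes $(j,i)$, $1\le j\le\lambda_1$, $1\le i\le\zeta_j=\#\{i:\lambda_i\ge j\}$. $R_\lambda=\{q_1<\cdots<q_r\}\subseteq[n-1]$ = column lengths less than $n$; $q_0=0$, $q_{r+1}=n$, $p_h=q_h-q_{h-1}$, carrels $(q_{h-1},q_h]$. $\lambda$-tuples $\nu\in[n]^n$; $U_\lambda(n)$ upper ones ($\nu_i\ge i$); $UI_\lambda(n)$ upper ones strictly increasing on each carrel. A $\lambda$-permutation is a permutation of $[n]$ strictly increasing on each carrel of $R_\lambda$; $\pi$ is $\lambda$-312-containing if there exist $h\in[r-1]$, $a\le q_h<b\le q_{h+1}<c\le n$ with $\pi_b<\pi_c<\pi_a$, else $\lambda$-312-avoiding. $\Psi_\lambda(\pi)_i=\mathrm{rank}^{q_h-i+1}(\{\pi_1,\dots,\pi_{q_h}\})$ for $i\in(q_{h-1},q_h]$. Gapless $\lambda$-tuple: $\gamma\in UI_\lambda(n)$ such that for each $h\in[r]$ with $\gamma_{q_h}>\gamma_{q_h+1}$, $s=\gamma_{q_h}-\gamma_{q_h+1}+1\le p_{h+1}$ and $\gamma_{q_h+t}=\gamma_{q_h}-s+t$, $t=1,\dots,s$. Critical indices of $\upsilon\in U_\lambda(n)$: in carrel $h$, $x_1=q_h$,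 and while possible $x_u$ = largest $x\in(q_{h-1},x_{u-1})$ with $\upsilon_{x_{u-1}}-\upsilon_x>x_{u-1}-x$. Core $\Delta_\lambda(\upsilon)$: equals $\upsilon_x$ at critical $x$ and $\upsilon_x-(x-i)$ at non-critical $i$, $x$ the smallest critical index $>i$. $UGC_\lambda(n)=\{\upsilon:\Delta_\lambda(\upsilon)\text{ gapless}\}$. For gapless $\gamma$: $\Phi_\lambda(\gamma)_i=\max\{\gamma_{q_h},\gamma_i\}$ if $h\in[r]$ and $q_h<i<x$ with $x$ the smallest critical index of $\gamma$ in $(q_h,q_{h+1}]$, else $\Phi_\lambda(\gamma)_i=\gamma_i$. Tableaux: $T_j(i)\in[n]$ strictly increasing down columns, weakly along rows; $\mathcal{T}_\lambda$, ordered entrywise. Content $\Theta(T)$, $x^{\Theta(T)}=\prod x_i^{\theta_i}$. $\mathcal{S}_\lambda(\beta)=\{T:T_j(i)\le\beta_i\ \forall(j,i)\}$, $s_\lambda(\beta;x)=\sum_{\mathcal{S}_\lambda(\beta)}x^{\Theta(T)}$ (a flag Schur polynomial when $\beta$ is an upper weakly increasing tuple); $Q_\lambda(\beta)$ = entrywise maximum of $\mathcal{S}_\lambda(\beta)$. $\lambda$-key $Y_\lambda(\pi)$: columns left to right are $\lambda_n$ copies of the column $[n]$, then for $h=r,\dots,1$, $\lambda_{q_h}-\lambda_{q_{h+1}}$ copies of the column with entries $\{\pi_1,\dots,\pi_{q_h}\}$ increasing downward. Scanning tableau $S(T)$: EWIS of $x_1,x_2,\dots$ is $x_{i_1},\dots$,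 $i_1=1$, $i_u$ smallest index $>i_{u-1}$ with $x_{i_u}\ge x_{i_{u-1}}$; column $j$ of $S(T)$: with columns $j,\dots,\lambda_1$ unmarked, repeat $\zeta_j$ times: read left to right the values of the lowest unmarked boxes of columns still having unmarked boxes, take the EWIS, mark its boxes, put its last value in the lowest empty box of column $j$. $\mathcal{D}_\lambda(\pi)=\{T:S(T)\le Y_\lambda(\pi)\}$, $d_\lambda(\pi;x)=\sum_{\mathcal{D}_\lambda(\pi)}x^{\Theta(T)}$. $\equiv$ means same shape and equal tableau sets. *)

theory Defs
  imports "HOL-Library.FuncSet" "HOL-Library.Poly_Mapping" "HOL-Combinatorics.Permutations"
begin

text \<open>
  Indices are 1-based. Tuples, in particular partitions, are extensional functions on
  \<open>{1..n}\<close>, so that equality of tuples is equality of functions.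
\<close>

definition partitions :: "nat \<Rightarrow> (nat \<Rightarrow> nat) set" where
  "partitions n = {lam \<in> {1..n} \<rightarrow>\<^sub>E UNIV. \<forall>i\<in>{1..n}. \<forall>k\<in>{1..n}. i \<le> k \<longrightarrow> lam k \<le> lam i}"

definition col_len :: "nat \<Rightarrow> (nat \<Rightarrow> nat) \<Rightarrow> nat \<Rightarrow> nat" where
  "col_len n lam j = card {i \<in> {1..n}. j \<le> lam i}"

definition shape :: "nat \<Rightarrow> (nat \<Rightarrow> nat) \<Rightarrow> (nat \<times> nat) set" where
  "shape n lam = {(j, i). 1 \<le> j \<and> j \<le> lam 1 \<and> 1 \<le> i \<and> i \<le> col_len n lam j}"

definition Rset :: "nat \<Rightarrow> (nat \<Rightarrow> nat) \<Rightarrow> nat set" where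
  "Rset n lam = {col_len n lam j | j. 1 \<le> j \<and> j \<le> lam 1 \<and> col_len n lam j < n}"

abbreviation rnum :: "nat \<Rightarrow> (nat \<Rightarrow> nat) \<Rightarrow> nat" where
  "rnum n lam \<equiv> card (Rset n lam)"

text \<open>\<open>q n lam h\<close> is \<open>q\<^sub>h\<close>, meaningful for \<open>0 \<le> h \<le> r + 1\<close>.\<close>

definition q :: "nat \<Rightarrow> (nat \<Rightarrow> nat) \<Rightarrow> nat \<Rightarrow> nat" where
  "q n lam h = (0 # sorted_list_of_set (Rset n lam) @ [n]) ! h"

definition p :: "nat \<Rightarrow> (nat \<Rightarrow> nat) \<Rightarrow> nat \<Rightarrow> nat" where
  "p n lam h = q n lam h - q n lam (h - 1)"

definition carrel :: "nat \<Rightarrow> (nat \<Rightarrow> nat) \<Rightarrow> nat \<Rightarrow> nat set" where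
  "carrel n lam h = {q n lam (h - 1)<..q n lam h}"

definition carrel_index :: "nat \<Rightarrow> (nat \<Rightarrow> nat) \<Rightarrow> nat \<Rightarrow> nat" where
  "carrel_index n lam i = (THE h. h \<in> {1..rnum n lam + 1} \<and> i \<in> carrel n lam h)"


subsection \<open>Tuples and permutations\<close>

text \<open>The set \<open>U\<^sub>\<lambda>(n)\<close> depends on \<open>n\<close> only.\<close>

definition upper_tuples :: "nat \<Rightarrow> (nat \<Rightarrow> nat) set" where
  "upper_tuples n = {\<nu> \<in> {1..n} \<rightarrow>\<^sub>E {1..n}. \<forall>i\<in>{1..n}. i \<le> \<nu> i}"

definition upper_flags :: "nat \<Rightarrow> (nat \<Rightarrow> nat) set" where
  "upper_flags n = {\<nu> \<in> upper_tuples n. mono_on {1..n} \<nu>}"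

definition upper_inc_tuples :: "nat \<Rightarrow> (nat \<Rightarrow> nat) \<Rightarrow> (nat \<Rightarrow> nat) set" where
  "upper_inc_tuples n lam =
    {\<nu> \<in> upper_tuples n. \<forall>h\<in>{1..rnum n lam + 1}. strict_mono_on (carrel n lam h) \<nu>}"

definition lam_permutations :: "nat \<Rightarrow> (nat \<Rightarrow> nat) \<Rightarrow> (nat \<Rightarrow> nat) set" where
  "lam_permutations n lam =
    {\<pi>. \<pi> permutes {1..n} \<and> (\<forall>h\<in>{1..rnum n lam + 1}. strict_mono_on (carrel n lam h) \<pi>)}"

definition lam_312_containing :: "nat \<Rightarrow> (nat \<Rightarrow> nat) \<Rightarrow> (nat \<Rightarrow> nat) \<Rightarrow> bool" where
  "lam_312_containing n lam \<pi> \<longleftrightarrow>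
    (\<exists>h\<in>{1..rnum n lam - 1}. \<exists>a b c.
      1 \<le> a \<and> a \<le> q n lam h \<and> q n lam h < b \<and> b \<le> q n lam (h + 1) \<and>
      q n lam (h + 1) < c \<and> c \<le> n \<and> \<pi> b < \<pi> c \<and> \<pi> c < \<pi> a)"

abbreviation lam_312_avoiding :: "nat \<Rightarrow> (nat \<Rightarrow> nat) \<Rightarrow> (nat \<Rightarrow> nat) \<Rightarrow> bool" where
  "lam_312_avoiding n lam \<pi> \<equiv> \<not> lam_312_containing n lam \<pi>"

definition dth_largest :: "nat \<Rightarrow> nat set \<Rightarrow> nat" where
  "dth_largest d Q = rev (sorted_list_of_set Q) ! (d - 1)"

definition Psi :: "nat \<Rightarrow> (nat \<Rightarrow> nat) \<Rightarrow> (nat \<Rightarrow> nat) \<Rightarrow> nat \<Rightarrow> nat" where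
  "Psi n lam \<pi> = (\<lambda>i\<in>{1..n}.
    let h = carrel_index n lam i in dth_largest (q n lam h - i + 1) (\<pi> ` {1..q n lam h}))"

definition gapless_tuples :: "nat \<Rightarrow> (nat \<Rightarrow> nat) \<Rightarrow> (nat \<Rightarrow> nat) set" where
  "gapless_tuples n lam = {\<gamma> \<in> upper_inc_tuples n lam.
    \<forall>h\<in>{1..rnum n lam}. \<gamma> (q n lam h) > \<gamma> (q n lam h + 1) \<longrightarrow>
      (let s = \<gamma> (q n lam h) - \<gamma> (q n lam h + 1) + 1
       in s \<le> p n lam (h + 1) \<and> (\<forall>t\<in>{1..s}. \<gamma> (q n lam h + t) = \<gamma> (q n lam h) - s + t))}"

definition critical_cands ::
    "nat \<Rightarrow> (nat \<Rightarrow> nat) \<Rightarrow> (nat \<Rightarrow> nat) \<Rightarrow> nat \<Rightarrow> nat \<Rightarrow> nat set" where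
  "critical_cands n lam \<upsilon> h x' =
    {x. q n lam (h - 1) < x \<and> x < x' \<and> int (\<upsilon> x') - int (\<upsilon> x) > int x' - int x}"

inductive_set critical_in ::
    "nat \<Rightarrow> (nat \<Rightarrow> nat) \<Rightarrow> (nat \<Rightarrow> nat) \<Rightarrow> nat \<Rightarrow> nat set"
  for n lam \<upsilon> h where
  first: "q n lam h \<in> critical_in n lam \<upsilon> h"
| step: "x \<in> critical_in n lam \<upsilon> h \<Longrightarrow> critical_cands n lam \<upsilon> h x \<noteq> {} \<Longrightarrow>
    Max (critical_cands n lam \<upsilon> h x) \<in> critical_in n lam \<upsilon> h"

definition critical :: "nat \<Rightarrow> (nat \<Rightarrow> nat) \<Rightarrow> (nat \<Rightarrow> nat) \<Rightarrow> nat set" where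
  "critical n lam \<upsilon> = (\<Union>h\<in>{1..rnum n lam + 1}. critical_in n lam \<upsilon> h)"

definition core :: "nat \<Rightarrow> (nat \<Rightarrow> nat) \<Rightarrow> (nat \<Rightarrow> nat) \<Rightarrow> nat \<Rightarrow> nat" where
  "core n lam \<upsilon> = (\<lambda>i\<in>{1..n}.
    if i \<in> critical n lam \<upsilon> then \<upsilon> i
    else let x = (LEAST x. x \<in> critical n lam \<upsilon> \<and> i < x) in \<upsilon> x - (x - i))"

definition UGC :: "nat \<Rightarrow> (nat \<Rightarrow> nat) \<Rightarrow> (nat \<Rightarrow> nat) set" where
  "UGC n lam = {\<upsilon> \<in> upper_tuples n. core n lam \<upsilon> \<in> gapless_tuples n lam}"

text \<open>Here \<open>h\<close> is the index with \<open>q\<^sub>h < i \<le> q\<^sub>h\<^sub>+\<^sub>1\<close>; it lies in \<open>[r]\<close> iff it is nonzero.\<close>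

definition Phi :: "nat \<Rightarrow> (nat \<Rightarrow> nat) \<Rightarrow> (nat \<Rightarrow> nat) \<Rightarrow> nat \<Rightarrow> nat" where
  "Phi n lam \<gamma> = (\<lambda>i\<in>{1..n}.
    let h = carrel_index n lam i - 1
    in if 1 \<le> h \<and> i < (LEAST x. x \<in> critical_in n lam \<gamma> (h + 1))
       then max (\<gamma> (q n lam h)) (\<gamma> i) else \<gamma> i)"


subsection \<open>Tableaux\<close>

text \<open>
  \<open>T j i\<close> is the entry in column \<open>j\<close>, row \<open>i\<close>. Entries outside the shape are 0, so
  the order \<open>\<le>\<close> on functions is the entrywise order, and equal tableaux have equal shapes.
\<close>

definition tableaux :: "nat \<Rightarrow> (nat \<Rightarrow> nat) \<Rightarrow> (nat \<Rightarrow> nat \<Rightarrow> nat) set" where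
  "tableaux n lam = {T.
    (\<forall>j i. (j, i) \<in> shape n lam \<longrightarrow> T j i \<in> {1..n}) \<and>
    (\<forall>j i. (j, i) \<notin> shape n lam \<longrightarrow> T j i = 0) \<and>
    (\<forall>j i. (j, i) \<in> shape n lam \<and> (j, i + 1) \<in> shape n lam \<longrightarrow> T j i < T j (i + 1)) \<and>
    (\<forall>j i. (j, i) \<in> shape n lam \<and> (j + 1, i) \<in> shape n lam \<longrightarrow> T j i \<le> T (j + 1) i)}"

definition content :: "nat \<Rightarrow> (nat \<Rightarrow> nat) \<Rightarrow> (nat \<Rightarrow> nat \<Rightarrow> nat) \<Rightarrow> nat \<Rightarrow> nat" where
  "content n lam T k = card {(j, i). (j, i) \<in> shape n lam \<and> T j i = k}"

text \<open>Polynomials over the integers, as finitely supported functions on exponent vectors.\<close>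

type_synonym mpol = "(nat \<Rightarrow>\<^sub>0 nat) \<Rightarrow>\<^sub>0 int"

definition X :: "nat \<Rightarrow> mpol" where
  "X i = Poly_Mapping.single (Poly_Mapping.single i 1) 1"

definition tab_monom :: "nat \<Rightarrow> (nat \<Rightarrow> nat) \<Rightarrow> (nat \<Rightarrow> nat \<Rightarrow> nat) \<Rightarrow> mpol" where
  "tab_monom n lam T = (\<Prod>i = 1..n. X i ^ content n lam T i)"

definition row_bound_set ::
    "nat \<Rightarrow> (nat \<Rightarrow> nat) \<Rightarrow> (nat \<Rightarrow> nat) \<Rightarrow> (nat \<Rightarrow> nat \<Rightarrow> nat) set" where
  "row_bound_set n lam \<beta> = {T \<in> tableaux n lam. \<forall>(j, i) \<in> shape n lam. T j i \<le> \<beta> i}"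

definition row_bound_sum :: "nat \<Rightarrow> (nat \<Rightarrow> nat) \<Rightarrow> (nat \<Rightarrow> nat) \<Rightarrow> mpol" where
  "row_bound_sum n lam \<beta> = (\<Sum>T\<in>row_bound_set n lam \<beta>. tab_monom n lam T)"

definition flag_schur_polys :: "nat \<Rightarrow> (nat \<Rightarrow> nat) \<Rightarrow> mpol set" where
  "flag_schur_polys n lam = row_bound_sum n lam ` upper_flags n"

definition Qmax :: "nat \<Rightarrow> (nat \<Rightarrow> nat) \<Rightarrow> (nat \<Rightarrow> nat) \<Rightarrow> nat \<Rightarrow> nat \<Rightarrow> nat" where
  "Qmax n lam \<beta> = (GREATEST T. T \<in> row_bound_set n lam \<beta>)"

definition key_columns :: "nat \<Rightarrow> (nat \<Rightarrow> nat) \<Rightarrow> (nat \<Rightarrow> nat) \<Rightarrow> nat set list" where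
  "key_columns n lam \<pi> = replicate (lam n) {1..n} @
    concat (map (\<lambda>h. replicate (lam (q n lam h) - lam (q n lam (h + 1))) (\<pi> ` {1..q n lam h}))
      (rev [1..<rnum n lam + 1]))"

definition key_tableau :: "nat \<Rightarrow> (nat \<Rightarrow> nat) \<Rightarrow> (nat \<Rightarrow> nat) \<Rightarrow> nat \<Rightarrow> nat \<Rightarrow> nat" where
  "key_tableau n lam \<pi> j i =
    (if (j, i) \<in> shape n lam
     then sorted_list_of_set (key_columns n lam \<pi> ! (j - 1)) ! (i - 1) else 0)"

text \<open>The earliest weakly increasing subsequence of a list, with respect to the values \<open>v\<close>.\<close>

function ewis :: "('a \<Rightarrow> nat) \<Rightarrow> 'a list \<Rightarrow> 'a list" where
  "ewis v [] = []"
| "ewis v (x # xs) = x # ewis v (dropWhile (\<lambda>y. v y < v x) xs)"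
  by pat_completeness auto
termination
  by (relation "measure (length \<circ> snd)") (auto simp: less_Suc_eq_le length_dropWhile_le)

text \<open>
  In each column boxes get marked from the bottom up, so the marking is recorded by the number
  \<open>u k\<close> of unmarked boxes of column \<open>k\<close>, and the lowest unmarked box is \<open>(k, u k)\<close>.
  The path is the list of the columns in which the selected boxes lie.
\<close>

definition scan_path ::
    "(nat \<Rightarrow> nat) \<Rightarrow> (nat \<Rightarrow> nat \<Rightarrow> nat) \<Rightarrow> nat \<Rightarrow> (nat \<Rightarrow> nat) \<Rightarrow> nat list" where
  "scan_path lam T j u = ewis (\<lambda>k. T k (u k)) (filter (\<lambda>k. 0 < u k) [j..<lam 1 + 1])"

fun scan_state ::
    "nat \<Rightarrow> (nat \<Rightarrow> nat) \<Rightarrow> (nat \<Rightarrow> nat \<Rightarrow> nat) \<Rightarrow> nat \<Rightarrow> nat \<Rightarrow> nat \<Rightarrow> nat" where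
  "scan_state n lam T j 0 = col_len n lam"
| "scan_state n lam T j (Suc t) =
    (let u = scan_state n lam T j t
     in (\<lambda>k. if k \<in> set (scan_path lam T j u) then u k - 1 else u k))"

text \<open>Row \<open>i\<close> of column \<open>j\<close> is filled after \<open>col_len n lam j - i\<close> earlier rounds.\<close>

definition scanning_tableau ::
    "nat \<Rightarrow> (nat \<Rightarrow> nat) \<Rightarrow> (nat \<Rightarrow> nat \<Rightarrow> nat) \<Rightarrow> nat \<Rightarrow> nat \<Rightarrow> nat" where
  "scanning_tableau n lam T j i =
    (if (j, i) \<in> shape n lam
     then let u = scan_state n lam T j (col_len n lam j - i); k = last (scan_path lam T j u)
          in T k (u k)
     else 0)"

definition demazure_set ::
    "nat \<Rightarrow> (nat \<Rightarrow> nat) \<Rightarrow> (nat \<Rightarrow> nat) \<Rightarrow> (nat \<Rightarrow> nat \<Rightarrow> nat) set" where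
  "demazure_set n lam \<pi> = {T \<in> tableaux n lam. scanning_tableau n lam T \<le> key_tableau n lam \<pi>}"

definition demazure_poly :: "nat \<Rightarrow> (nat \<Rightarrow> nat) \<Rightarrow> (nat \<Rightarrow> nat) \<Rightarrow> mpol" where
  "demazure_poly n lam \<pi> = (\<Sum>T\<in>demazure_set n lam \<pi>. tab_monom n lam T)"

end

theory Submission
  imports Defs
begin

text \<open>
  The maximum of \<open>\<S>\<^sub>\<lambda>(\<beta>)\<close> has the entry \<open>min\<^sub>k (\<beta>\<^sub>k - (k - i))\<close>, \<open>i \<le> k \<le> \<zeta>\<^sub>j\<close>, in column \<open>j\<close> and
  row \<open>i\<close>; on the last carrel meeting column \<open>j\<close> this is the core of \<open>\<beta>\<close>. On the other side
  \<open>T \<le> S(T)\<close> and \<open>S(Y) = Y\<close> for a key \<open>Y\<close>, so \<open>Y\<close> is the maximum of \<open>\<D>\<^sub>\<lambda>(\<pi>)\<close>.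

  A column has at most \<open>k\<close> entries in a set of \<open>k\<close> values. Counting entries in
  \<open>{\<pi>\<^sub>1, \<dots>, \<pi>\<^sub>k}\<close>, equality of the polynomials therefore forces equal shapes, and the key is the
  only tableau of its content. Hence \<open>Y \<in> \<S>\<^sub>\<lambda>(\<beta>)\<close> and \<open>Y \<le> Q\<close>; some \<open>T \<in> \<D>\<^sub>\<lambda>(\<pi>)\<close> has the content
  of \<open>Q\<close>, and \<open>T \<le> Y \<le> Q\<close> with equal sums of entries gives \<open>Y = Q\<close>. As \<open>\<S>\<^sub>\<lambda>(\<beta>)\<close> consists of all
  tableaux below \<open>Q\<close>, it contains \<open>\<D>\<^sub>\<lambda>(\<pi>)\<close>, and the two are equal by counting. So \<open>\<D>\<^sub>\<lambda>(\<pi>)\<close> is a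
  principal ideal, which a 312 pattern in \<open>\<pi>\<close> would contradict; avoidance makes \<open>\<Psi>\<^sub>\<lambda>(\<pi>)\<close> gapless.
\<close>

section \<open>Elements of a finite set by rank\<close>

text \<open>Ranks start at 1 and count from below, like the rows of a column, whereas
  \<open>dth_largest\<close> counts from above. Values are meaningful only for \<open>i\<close> in
  \<open>{1..card B}\<close>.\<close>

definition elt :: "nat set \<Rightarrow> nat \<Rightarrow> nat" where
  "elt B i = sorted_list_of_set B ! (i - 1)"

lemma elt_strict_mono:
  assumes "finite B" "1 \<le> i" "i < k" "k \<le> card B"
  shows "elt B i < elt B k"
  unfolding elt_def
  by (rule sorted_wrt_nth_less[OF strict_sorted_list_of_set]) (use assms in auto)

lemma elt_image:
  assumes "finite B"
  shows "elt B ` {1..card B} = B"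
proof -
  have "elt B ` {1..card B} = (\<lambda>k. sorted_list_of_set B ! k) ` {..<card B}"
    unfolding elt_def
    by (simp add: image_image lessThan_atLeast0 flip: image_Suc_atLeastLessThan atLeastLessThanSuc_atLeastAtMost)
  also have "\<dots> = set (sorted_list_of_set B)"
    by (auto simp: set_conv_nth)
  finally show ?thesis using assms by simp
qed

lemma elt_in:
  assumes "finite B" "1 \<le> i" "i \<le> card B"
  shows "elt B i \<in> B"
  using elt_image[OF assms(1)] assms by auto

lemma elt_less_iff:
  assumes "finite B" "1 \<le> i" "i \<le> card B" "1 \<le> k" "k \<le> card B"
  shows "elt B i < elt B k \<longleftrightarrow> i < k"
  using assms elt_strict_mono[of B] by (metis linorder_neqE_nat order_less_asym)

lemma elt_le_elt_iff:
  assumes "finite B" "1 \<le> i" "i \<le> card B" "1 \<le> k" "k \<le> card B"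
  shows "elt B i \<le> elt B k \<longleftrightarrow> i \<le> k"
  using elt_less_iff[OF assms(1,4,5,2,3)] by (simp flip: not_less)

lemma inj_on_elt: "finite B \<Longrightarrow> inj_on (elt B) {1..card B}"
  by (rule linorder_inj_onI) (auto simp: less_imp_neq elt_strict_mono)

text \<open>As \<open>elt B\<close> is increasing, the elements up to \<open>v\<close> occupy an
  initial segment of ranks. Comparisons of entries thus become comparisons of counts, which is how
  columns with different sets of entries are compared.\<close>

lemma elt_le_iff:
  assumes "finite B" "1 \<le> i" "i \<le> card B"
  shows "elt B i \<le> v \<longleftrightarrow> i \<le> card {x \<in> B. x \<le> v}"
proof -
  let ?K = "{k \<in> {1..card B}. elt B k \<le> v}"
  have "{x \<in> B. x \<le> v} = elt B ` ?K"
    by (subst (1) elt_image[OF assms(1), symmetric]) auto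
  then have card: "card {x \<in> B. x \<le> v} = card ?K"
    by (metis (no_types, lifting) card_image inj_on_elt[OF assms(1)] inj_on_subset mem_Collect_eq subsetI)
  show ?thesis
  proof
    assume "elt B i \<le> v"
    then have "{1..i} \<subseteq> ?K"
      using assms by (auto simp: elt_le_elt_iff[OF assms(1)] intro: order_trans[of _ "elt B i"])
    then have "card {1..i} \<le> card ?K" by (intro card_mono) auto
    then show "i \<le> card {x \<in> B. x \<le> v}" using card by simp
  next
    assume *: "i \<le> card {x \<in> B. x \<le> v}"
    show "elt B i \<le> v"
    proof (rule ccontr)
      assume "\<not> elt B i \<le> v"
      then have "?K \<subseteq> {1..<i}"
        using assms elt_le_elt_iff[OF assms(1,2,3)] by (auto simp: not_le) (meson leD le_less_trans not_le)
      then have "card ?K \<le> card {1..<i}" by (intro card_mono) auto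
      then show False using * card assms by simp
    qed
  qed
qed

lemma elt_card_le:
  assumes "finite B" "x \<in> B"
  shows "elt B (card {y \<in> B. y \<le> x}) = x"
proof -
  obtain i where i: "1 \<le> i" "i \<le> card B" "x = elt B i"
  proof -
    from assms have "x \<in> elt B ` {1..card B}" by (simp only: elt_image)
    then show ?thesis using that by auto
  qed
  let ?c = "card {y \<in> B. y \<le> x}"
  have c: "i \<le> ?c" "?c \<le> card B"
    using elt_le_iff[OF assms(1) i(1,2), of x] i assms(1) by (auto intro: card_mono)
  have "elt B ?c \<le> x" using c i(1) by (intro iffD2[OF elt_le_iff[OF assms(1)]]) auto
  moreover have "elt B i \<le> elt B ?c" using c i(1,2) by (subst elt_le_elt_iff[OF assms(1)]) auto
  ultimately show ?thesis using i(3) by simp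
qed

lemma card_le_elt:
  assumes "finite B" "1 \<le> i" "i \<le> card B"
  shows "card {x \<in> B. x \<le> elt B i} = i"
proof -
  let ?c = "card {x \<in> B. x \<le> elt B i}"
  have c: "i \<le> ?c" "?c \<le> card B"
    using elt_le_iff[OF assms, of "elt B i"] assms(1) by (auto intro: card_mono)
  have "elt B ?c = elt B i" using assms by (intro elt_card_le elt_in)
  then show ?thesis using inj_onD[OF inj_on_elt[OF assms(1)], of ?c i] c assms by auto
qed

text \<open>A larger set has at least as many elements below any threshold. This is why nested
  column sets give weakly increasing rows.\<close>

lemma elt_mono:
  assumes "finite B" "B' \<subseteq> B" "1 \<le> i" "i \<le> card B'"
  shows "elt B i \<le> elt B' i"
proof -
  have fin: "finite B'" and c: "i \<le> card B"
    using assms finite_subset card_mono[OF assms(1,2)] by auto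
  have "i \<le> card {x \<in> B'. x \<le> elt B' i}"
    using elt_le_iff[OF fin assms(3,4)] by blast
  also have "\<dots> \<le> card {x \<in> B. x \<le> elt B' i}"
    using assms by (intro card_mono) auto
  finally show ?thesis using elt_le_iff[OF assms(1,3) c] by blast
qed

lemma elt_exchange_le:
  assumes "finite B" "x \<in> B" "y \<notin> B" "y < x" "1 \<le> i" "i \<le> card B"
  shows "elt (insert y (B - {x})) i \<le> elt B i"
proof -
  let ?B = "insert y (B - {x})" and ?v = "elt B i"
  have "0 < card B" using assms by (auto simp: card_gt_0_iff)
  then have c: "card ?B = card B" using assms by simp
  have "i \<le> card {z \<in> B. z \<le> ?v}" using elt_le_iff[OF assms(1,5,6)] by blast
  \<comment> \<open>Replacing \<open>x\<close> by \<open>y\<close> stays below the threshold because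
    \<open>y < x\<close>, and is injective because \<open>y \<notin> B\<close>.\<close>
  also have "\<dots> \<le> card {z \<in> ?B. z \<le> ?v}"
    by (rule card_inj_on_le[of "\<lambda>z. if z = x then y else z"])
      (use assms in \<open>auto simp: inj_on_def\<close>)
  finally show ?thesis using elt_le_iff[of ?B i ?v] assms c by auto
qed

text \<open>A strictly increasing list is the sorted list of its set, so a column is recovered from
  its set of entries.\<close>

lemma elt_unique:
  assumes "strict_mono_on {1..m} f" "f ` {1..m} = B" "i \<in> {1..m}"
  shows "f i = elt B i"
proof -
  let ?xs = "map f [1..<Suc m]"
  have "sorted_wrt (<) ?xs"
    using assms(1) by (auto simp: sorted_wrt_iff_nth_less strict_mono_on_def nth_append)
  moreover have "set ?xs = B" using assms(2) by (simp only: set_map set_upt atLeastLessThanSuc_atLeastAtMost)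
  ultimately have "sorted_list_of_set B = ?xs"
    by (intro strict_sorted_equal strict_sorted_list_of_set) auto
  then have "elt B i = ?xs ! (i - 1)" by (simp only: elt_def)
  also have "\<dots> = f i" using assms(3) by (subst nth_map) (auto simp del: upt_Suc)
  finally show ?thesis by simp
qed

lemma elt_atLeastAtMost: "i \<in> {1..m} \<Longrightarrow> elt {1..m} i = i"
  using elt_unique[of m "\<lambda>i. i" "{1..m}" i] by (simp add: strict_mono_on_def)

lemma dth_largest_eq_elt:
  assumes "card B = m" "1 \<le> i" "i \<le> m"
  shows "dth_largest (m - i + 1) B = elt B i"
  using assms by (simp add: dth_largest_def elt_def rev_nth)

section \<open>Earliest weakly increasing subsequences\<close>

lemma set_ewis_subset: "set (ewis v xs) \<subseteq> set xs"
  by (induction v xs rule: ewis.induct) (auto dest: set_dropWhileD)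

lemma ewis_eq_Nil_iff [simp]: "ewis v xs = [] \<longleftrightarrow> xs = []"
  by (cases xs) auto

lemma sorted_ewis: "sorted (map v (ewis v xs))"
proof (induction v xs rule: ewis.induct)
  case (2 v x xs)
  show ?case
  proof (cases "dropWhile (\<lambda>y. v y < v x) xs")
    case (Cons z zs)
    then have "\<not> v z < v x" by (metis hd_dropWhile list.distinct(1) list.sel(1))
    with 2 Cons show ?thesis by (auto simp: not_less intro: order_trans)
  qed (simp del: dropWhile_eq_Nil_conv)
qed simp

lemma ewis_le_last:
  assumes "k \<in> set (ewis v xs)"
  shows "v k \<le> v (last (ewis v xs))"
proof -
  have "ewis v xs = butlast (ewis v xs) @ [last (ewis v xs)]"
    using assms append_butlast_last_id[of "ewis v xs"] by (cases "ewis v xs") simp_all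
  then have "sorted (map v (butlast (ewis v xs) @ [last (ewis v xs)]))"
    using sorted_ewis[of v xs] by simp
  moreover have "k \<in> set (butlast (ewis v xs) @ [last (ewis v xs)])" 
    using assms \<open>ewis v xs = _\<close> by simp
  ultimately show ?thesis by (auto simp: sorted_append)
qed

lemma head_le_ewis: "k \<in> set (ewis v (x # xs)) \<Longrightarrow> v x \<le> v k"
  using sorted_ewis[of v "x # xs"] by auto

text \<open>The next selected element is the first one that is not below the head, hence a tie when
  the head is a maximum; no tie is skipped. The paths that scan a key are of this kind.\<close>

lemma set_ewis_max_head:
  assumes "\<forall>y\<in>set xs. v y \<le> v x"
  shows "set (ewis v (x # xs)) = {y \<in> set (x # xs). v y = v x}"
  using assms
proof (induction "length xs" arbitrary: x xs rule: less_induct)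
  case less
  have tw: "\<forall>y\<in>set (takeWhile (\<lambda>y. v y < v x) xs). v y < v x"
    by (auto dest: set_takeWhileD)
  have xs: "set xs = set (takeWhile (\<lambda>y. v y < v x) xs) \<union> set (dropWhile (\<lambda>y. v y < v x) xs)"
    by (metis set_append takeWhile_dropWhile_id)
  show ?case
  proof (cases "dropWhile (\<lambda>y. v y < v x) xs")
    case Nil
    then have "set xs = set (takeWhile (\<lambda>y. v y < v x) xs)" using xs by (simp del: dropWhile_eq_Nil_conv)
    then have "\<forall>y\<in>set xs. v y < v x" using tw by simp
    then have "{y \<in> set (x # xs). v y = v x} = {x}" by fastforce
    then show ?thesis by (simp only: ewis.simps Nil list.set)
  next
    case (Cons z zs)
    then have "\<not> v z < v x" by (metis hd_dropWhile list.distinct(1) list.sel(1))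
    moreover have "z \<in> set xs" "set zs \<subseteq> set xs" using xs Cons by auto
    ultimately have z: "v z = v x" using less.prems by (meson antisym not_less)
    then have zs: "\<forall>y\<in>set zs. v y \<le> v z" using less.prems \<open>set zs \<subseteq> set xs\<close> by auto
    have "length zs < length xs"
      using Cons length_dropWhile_le[of "\<lambda>y. v y < v x" xs] by simp
    have xs': "set xs = set (takeWhile (\<lambda>y. v y < v x) xs) \<union> set (z # zs)"
      using xs Cons by simp
    have "set (ewis v (x # xs)) = insert x {y \<in> set (z # zs). v y = v x}"
      using less.hyps[OF \<open>length zs < length xs\<close> zs] Cons z by simp
    also have "\<dots> = {y \<in> set (x # xs). v y = v x}"
      using tw unfolding list.set(2)[of x xs] xs' by auto
    finally show ?thesis .
  qed
qed

section \<open>Carrels and keys\<close>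

locale partition_shape =
  fixes n :: nat and lam :: "nat \<Rightarrow> nat"
  assumes n_pos: "1 \<le> n" and lam: "lam \<in> partitions n"
begin

abbreviation zeta :: "nat \<Rightarrow> nat" where "zeta \<equiv> col_len n lam"
abbreviation r :: nat where "r \<equiv> rnum n lam"
abbreviation qq :: "nat \<Rightarrow> nat" where "qq \<equiv> q n lam"

section \<open>Rows and columns of a partition shape\<close>

lemma lam_antimono: "1 \<le> i \<Longrightarrow> i \<le> k \<Longrightarrow> k \<le> n \<Longrightarrow> lam k \<le> lam i"
  using lam by (auto simp: partitions_def)

text \<open>The rows of length at least \<open>j\<close> form an initial segment. This is the
  duality of a partition and its conjugate, through which rows and columns are translated into each
  other.\<close>

lemma le_zeta_iff:
  assumes "1 \<le> i" "i \<le> n"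
  shows "i \<le> zeta j \<longleftrightarrow> j \<le> lam i"
proof
  assume "j \<le> lam i"
  then have "{1..i} \<subseteq> {i \<in> {1..n}. j \<le> lam i}"
    using assms by (auto intro: order_trans[OF _ lam_antimono])
  then have "card {1..i} \<le> zeta j" unfolding col_len_def by (intro card_mono) auto
  then show "i \<le> zeta j" by simp
next
  assume *: "i \<le> zeta j"
  show "j \<le> lam i"
  proof (rule ccontr)
    assume "\<not> j \<le> lam i"
    then have "{i \<in> {1..n}. j \<le> lam i} \<subseteq> {1..<i}"
      using lam_antimono[OF assms(1)] by (auto simp: not_le) (meson leD le_less_trans not_le)
    then have "zeta j \<le> card {1..<i}" unfolding col_len_def by (intro card_mono) auto
    then show False using * assms by simp
  qed
qed

lemma zeta_le: "zeta j \<le> n"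
proof -
  have "zeta j \<le> card {1..n}" unfolding col_len_def by (intro card_mono) auto
  then show ?thesis by simp
qed

lemma zeta_antimono: "j \<le> k \<Longrightarrow> zeta k \<le> zeta j"
  unfolding col_len_def by (intro card_mono) auto

lemma zeta_pos: "j \<le> lam 1 \<Longrightarrow> 1 \<le> zeta j"
  using le_zeta_iff[of 1 j] n_pos by simp

lemma shape_iff: "(j, i) \<in> shape n lam \<longleftrightarrow> j \<in> {1..lam 1} \<and> i \<in> {1..zeta j}"
  by (auto simp: shape_def)

lemma shape_iff_row: "(j, i) \<in> shape n lam \<longleftrightarrow> i \<in> {1..n} \<and> j \<in> {1..lam i}"
proof (cases "i \<in> {1..n}")
  case True
  then have "lam i \<le> lam 1" by (intro lam_antimono) auto
  with True show ?thesis using le_zeta_iff[of i j] by (auto simp: shape_iff)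
next
  case False
  then show ?thesis using zeta_le[of j] by (auto simp: shape_iff)
qed

section \<open>Column lengths and carrels\<close>

lemma Rset_subset: "Rset n lam \<subseteq> {1..<n}"
  using zeta_pos by (auto simp: Rset_def)

lemma finite_Rset: "finite (Rset n lam)"
  using Rset_subset finite_subset by blast

lemma q_0: "qq 0 = 0"
  by (simp add: q_def)

lemma q_last: "qq (Suc r) = n"
  using finite_Rset by (simp add: q_def nth_append)

lemma q_strict_mono: "h < h' \<Longrightarrow> h' \<le> Suc r \<Longrightarrow> qq h < qq h'"
proof -
  assume h: "h < h'" "h' \<le> Suc r"
  let ?xs = "0 # sorted_list_of_set (Rset n lam) @ [n]"
  have "sorted_wrt (<) ?xs"
    using Rset_subset finite_Rset n_pos by (auto simp: sorted_wrt_append)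
  then have "?xs ! h < ?xs ! h'"
    by (rule sorted_wrt_nth_less) (use h finite_Rset in auto)
  then show ?thesis by (simp only: q_def)
qed

lemma q_less_iff: "h \<le> Suc r \<Longrightarrow> h' \<le> Suc r \<Longrightarrow> qq h < qq h' \<longleftrightarrow> h < h'"
  using q_strict_mono by (metis linorder_neqE_nat order_less_asym less_irrefl)

lemma q_le: "h \<le> Suc r \<Longrightarrow> qq h \<le> n"
  using q_strict_mono[of h "Suc r"] q_last by (cases "h = Suc r") auto

lemma q_pos: "1 \<le> h \<Longrightarrow> h \<le> Suc r \<Longrightarrow> 1 \<le> qq h"
  using q_strict_mono[of 0 h] by simp

lemma q_in_Rset:
  assumes "h \<in> {1..r}"
  shows "qq h \<in> Rset n lam"
proof -
  have "qq h = sorted_list_of_set (Rset n lam) ! (h - 1)"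
    using assms finite_Rset by (auto simp: q_def nth_append nth_Cons split: nat.split)
  also have "\<dots> \<in> set (sorted_list_of_set (Rset n lam))"
    using assms finite_Rset by (intro nth_mem) auto
  finally show ?thesis using finite_Rset by simp
qed

lemma Rset_eq_q:
  assumes "x \<in> Rset n lam"
  shows "\<exists>h\<in>{1..r}. qq h = x"
proof -
  have "x \<in> set (sorted_list_of_set (Rset n lam))" using assms finite_Rset by simp
  then obtain k where "k < r" "sorted_list_of_set (Rset n lam) ! k = x"
    by (metis in_set_conv_nth length_sorted_list_of_set)
  then show ?thesis using finite_Rset
    by (intro bexI[of _ "Suc k"]) (auto simp: q_def nth_append)
qed

lemma zeta_eq_q:
  assumes "1 \<le> j" "j \<le> lam 1"
  shows "\<exists>h\<in>{1..Suc r}. zeta j = qq h"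
proof (cases "zeta j < n")
  case True
  then have "zeta j \<in> Rset n lam" using assms by (auto simp: Rset_def)
  then show ?thesis using Rset_eq_q by force
next
  case False
  then show ?thesis using q_last zeta_le[of j] by (intro bexI[of _ "Suc r"]) auto
qed

lemma carrel_iff: "i \<in> carrel n lam h \<longleftrightarrow> qq (h - 1) < i \<and> i \<le> qq h"
  by (simp add: carrel_def)

lemma carrel_subset: "h \<in> {1..Suc r} \<Longrightarrow> i \<in> carrel n lam h \<Longrightarrow> i \<in> {1..n}"
  using q_le[of h] by (auto simp: carrel_iff)

lemma carrel_unique:
  assumes "h \<in> {1..Suc r}" "h' \<in> {1..Suc r}" "i \<in> carrel n lam h" "i \<in> carrel n lam h'"
  shows "h = h'"
proof -
  have "qq (h - 1) < qq h'" "qq (h' - 1) < qq h" using assms by (auto simp: carrel_iff)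
  moreover have "h - 1 \<le> Suc r" "h' - 1 \<le> Suc r" "h \<le> Suc r" "h' \<le> Suc r"
    using assms by auto
  ultimately have "h - 1 < h'" "h' - 1 < h" by (simp_all add: q_less_iff)
  then show ?thesis using assms by auto
qed

lemma carrel_index_eq: "h \<in> {1..Suc r} \<Longrightarrow> i \<in> carrel n lam h \<Longrightarrow> carrel_index n lam i = h"
  unfolding carrel_index_def by (rule the_equality) (use carrel_unique in auto)

lemma carrel_cases:
  assumes "i \<in> {1..n}"
  obtains h where "h \<in> {1..Suc r}" "i \<in> carrel n lam h"
proof -
  define h where "h = (LEAST h. i \<le> qq h)"
  have h: "i \<le> qq h" "h \<le> Suc r"
    unfolding h_def using assms q_last by (auto intro: LeastI[of _ "Suc r"] Least_le)
  then have "h \<noteq> 0" using q_0 assms by (metis atLeastAtMost_iff le_zero_eq not_one_le_zero)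
  then have "\<not> i \<le> qq (h - 1)"
    unfolding h_def by (metis Suc_pred' neq0_conv not_less_Least lessI)
  with h \<open>h \<noteq> 0\<close> show ?thesis by (intro that[of h]) (auto simp: carrel_iff)
qed

lemma q_in_carrel: "h \<in> {1..Suc r} \<Longrightarrow> qq h \<in> carrel n lam h"
  using q_strict_mono[of "h - 1" h] by (auto simp: carrel_iff)

lemma Suc_q_in_carrel: "h \<in> {1..r} \<Longrightarrow> Suc (qq h) \<in> carrel n lam (Suc h)"
  using q_strict_mono[of h "Suc h"] by (auto simp: carrel_iff)

text \<open>The length of a column is itself one of the \<open>q\<close>, so a column that reaches
  into a carrel contains all of it.\<close>

lemma q_le_zeta:
  assumes "h \<in> {1..Suc r}" "i \<in> carrel n lam h" "(j, i) \<in> shape n lam"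
  shows "qq h \<le> zeta j"
proof -
  obtain h' where h': "h' \<in> {1..Suc r}" "zeta j = qq h'"
    using zeta_eq_q[of j] assms(3) by (auto simp: shape_iff)
  have "qq (h - 1) < qq h'" using assms h' by (auto simp: carrel_iff shape_iff)
  then have "h - 1 < h'" using q_less_iff[of "h - 1" h'] assms h' by auto
  then show ?thesis using h' assms q_less_iff[of h' h] by (auto simp flip: not_less)
qed

text \<open>The last column that reaches row \<open>i\<close> contains the whole carrel and so
  reaches row \<open>qq h\<close>.\<close>

lemma lam_const:
  assumes "h \<in> {1..Suc r}" "i \<in> carrel n lam h"
  shows "lam i = lam (qq h)"
proof (rule antisym)
  note i = carrel_subset[OF assms]
  show "lam (qq h) \<le> lam i"
    using i assms q_le[of h] by (intro lam_antimono) (auto simp: carrel_iff)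
  show "lam i \<le> lam (qq h)"
  proof (cases "lam i = 0")
    case False
    then have "(lam i, i) \<in> shape n lam" using i by (auto simp: shape_iff_row)
    from q_le_zeta[OF assms this] show ?thesis
      using le_zeta_iff[of "qq h" "lam i"] q_le[of h] q_pos[of h] assms by auto
  qed simp
qed

lemma lam_q_Suc: "h \<in> {1..r} \<Longrightarrow> lam (Suc (qq h)) = lam (qq (Suc h))"
  using lam_const[of "Suc h"] Suc_q_in_carrel by auto

text \<open>Such a column reaches row \<open>qq h\<close> but not the row after it, which starts the
  next carrel and has length \<open>lam (qq (Suc h))\<close>.\<close>

lemma zeta_eq_q_iff:
  assumes "h \<in> {1..r}"
  shows "zeta j = qq h \<longleftrightarrow> lam (qq (Suc h)) < j \<and> j \<le> lam (qq h)"
proof -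
  have "qq h < n" "1 \<le> qq h"
    using assms q_strict_mono[of h "Suc r"] q_last q_pos[of h] by auto
  then show ?thesis
    using le_zeta_iff[of "qq h" j] le_zeta_iff[of "Suc (qq h)" j] lam_q_Suc[OF assms] by auto
qed

lemma lam_q_less:
  assumes "h \<in> {1..r}"
  shows "lam (qq (Suc h)) < lam (qq h)"
proof -
  obtain j where "zeta j = qq h" using q_in_Rset[OF assms] by (auto simp: Rset_def)
  then show ?thesis using zeta_eq_q_iff[OF assms, of j] by simp
qed

lemma lam_q_1: "lam (qq 1) = lam 1"
  using lam_const[of 1 1] q_0 q_pos[of 1] by (auto simp: carrel_iff)

section \<open>Columns of a key\<close>

lemma card_perm_image: "\<pi> permutes {1..n} \<Longrightarrow> card (\<pi> ` A) = card A"
  by (rule card_image) (metis permutes_inj inj_on_subset subset_UNIV)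

lemma perm_image_subset: "\<pi> permutes {1..n} \<Longrightarrow> m \<le> n \<Longrightarrow> \<pi> ` {1..m} \<subseteq> {1..n}"
  using permutes_image[of \<pi> "{1..n}"] by auto

lemma key_columns_nth:
  assumes "\<pi> permutes {1..n}" "j \<in> {1..lam 1}"
  shows "key_columns n lam \<pi> ! (j - 1) = \<pi> ` {1..zeta j}"
proof -
  \<comment> \<open>\<open>K m\<close> is the initial block of the columns of length at least
    \<open>qq m\<close>. The induction runs down from \<open>K (Suc r)\<close>, where only the
    columns of length \<open>n\<close> remain, to \<open>K 1\<close>, the whole list.\<close>
  define K where "K m = replicate (lam n) {1..n} @
    concat (map (\<lambda>h. replicate (lam (qq h) - lam (qq (h + 1))) (\<pi> ` {1..qq h}))
      (rev [m..<r + 1]))" for m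
  have "length (K m) = lam (qq m) \<and> (\<forall>k<length (K m). K m ! k = \<pi> ` {1..zeta (Suc k)})"
    if "1 \<le> m" "m \<le> Suc r" for m
    using that(2,1)
  proof (induction rule: inc_induct)
    case base
    have "zeta (Suc k) = n" if "k < lam n" for k
      using le_zeta_iff[of n "Suc k"] that n_pos zeta_le[of "Suc k"] by auto
    then show ?case
      using permutes_image[OF assms(1)] by (simp add: K_def q_last)
  next
    case (step m)
    let ?l = "lam (qq m) - lam (qq (Suc m))"
    have m: "m \<in> {1..r}" using step by auto
    have K: "K m = K (Suc m) @ replicate ?l (\<pi> ` {1..qq m})"
    proof -
      have "[m..<r + 1] = m # [Suc m..<r + 1]" using m by (intro upt_conv_Cons) auto
      then show ?thesis by (simp add: K_def del: upt_Suc)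
    qed
    have IH: "length (K (Suc m)) = lam (qq (Suc m))"
      "\<forall>k<length (K (Suc m)). K (Suc m) ! k = \<pi> ` {1..zeta (Suc k)}"
      using step by auto
    have "zeta (Suc k) = qq m" if "lam (qq (Suc m)) \<le> k" "k < lam (qq m)" for k
      using zeta_eq_q_iff[OF m, of "Suc k"] that by auto
    then show ?case
      using IH lam_q_less[OF m] by (auto simp: K nth_append)
  qed
  from this[of 1] have "\<forall>k<lam 1. K 1 ! k = \<pi> ` {1..zeta (Suc k)}"
    using lam_q_1 by simp
  then have "K 1 ! (j - 1) = \<pi> ` {1..zeta (Suc (j - 1))}"
    using assms(2) by auto
  then show ?thesis
    using assms(2) by (simp add: K_def key_columns_def)
qed

lemma key_tableau_eq:
  assumes "\<pi> permutes {1..n}" "(j, i) \<in> shape n lam"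
  shows "key_tableau n lam \<pi> j i = elt (\<pi> ` {1..zeta j}) i"
  using assms key_columns_nth[OF assms(1), of j] by (simp add: key_tableau_def elt_def shape_iff)

text \<open>Rows increase weakly because the column lengths decrease to the right, so the column
  sets are nested and \<open>elt_mono\<close> applies.\<close>

lemma key_in_tableaux:
  assumes "\<pi> permutes {1..n}"
  shows "key_tableau n lam \<pi> \<in> tableaux n lam"
proof -
  let ?Y = "key_tableau n lam \<pi>"
  have "?Y j i \<in> {1..n}" if "(j, i) \<in> shape n lam" for j i
    using that key_tableau_eq[OF assms that] perm_image_subset[OF assms zeta_le[of j]]
      elt_in[of "\<pi> ` {1..zeta j}" i] card_perm_image[OF assms, of "{1..zeta j}"]
    by (auto simp: shape_iff)
  moreover have "?Y j i = 0" if "(j, i) \<notin> shape n lam" for j i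
    using that by (simp add: key_tableau_def)
  moreover have "?Y j i < ?Y j (i + 1)"
    if "(j, i) \<in> shape n lam" "(j, i + 1) \<in> shape n lam" for j i
    using that card_perm_image[OF assms, of "{1..zeta j}"]
    by (auto simp: key_tableau_eq[OF assms] shape_iff intro!: elt_strict_mono)
  moreover have "?Y j i \<le> ?Y (j + 1) i"
    if "(j, i) \<in> shape n lam" "(j + 1, i) \<in> shape n lam" for j i
    using that card_perm_image[OF assms, of "{1..zeta (j + 1)}"] zeta_antimono[of j "j + 1"]
    by (simp only: key_tableau_eq[OF assms]) (auto simp: shape_iff intro!: elt_mono)
  ultimately show ?thesis by (auto simp: tableaux_def)
qed

end

section \<open>Contents and the uniqueness of keys\<close>

lemma card_atMost_filter: "card {i \<in> {1..z}. i \<le> k} = min k (z :: nat)"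
proof -
  have "{i \<in> {1..z}. i \<le> k} = {1..min k z}" by auto
  then show ?thesis by simp
qed

context partition_shape
begin

lemma shape_eq_Sigma: "shape n lam = Sigma {1..lam 1} (\<lambda>j. {1..zeta j})"
  by (auto simp: shape_iff)

lemma finite_shape: "finite (shape n lam)"
  by (simp add: shape_eq_Sigma)

text \<open>Entries vanish off the finite shape, so uncurried tableaux lie in a finite function
  space.\<close>

lemma finite_tableaux: "finite (tableaux n lam)"
proof -
  let ?F = "{f. \<forall>x. (x \<in> shape n lam \<longrightarrow> f x \<in> {1..n}) \<and> (x \<notin> shape n lam \<longrightarrow> f x = 0)}"
  have "finite ?F" by (intro finite_set_of_finite_funs finite_shape) simp
  moreover have "tableaux n lam \<subseteq> curry ` ?F"
  proof
    fix T assume "T \<in> tableaux n lam"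
    then have "case_prod T \<in> ?F" by (auto simp: tableaux_def)
    then have "curry (case_prod T) \<in> curry ` ?F" by (rule imageI)
    then show "T \<in> curry ` ?F" by simp
  qed
  ultimately show ?thesis by (rule finite_surj)
qed

lemma tableaux_range: "T \<in> tableaux n lam \<Longrightarrow> (j, i) \<in> shape n lam \<Longrightarrow> T j i \<in> {1..n}"
  by (simp add: tableaux_def)

lemma tableaux_outside: "T \<in> tableaux n lam \<Longrightarrow> (j, i) \<notin> shape n lam \<Longrightarrow> T j i = 0"
  by (simp add: tableaux_def)

lemma tableaux_column:
  assumes T: "T \<in> tableaux n lam" and "1 \<le> i" "i \<le> k" "(j, k) \<in> shape n lam"
  shows "T j i + (k - i) \<le> T j k"
  using assms(3,4)
proof (induction rule: dec_induct)
  case base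
  then show ?case by simp
next
  case (step k)
  then have s: "(j, k) \<in> shape n lam" using assms(2) by (auto simp: shape_iff)
  then have "T j k < T j (k + 1)" using T step.prems by (simp add: tableaux_def)
  then show ?case using step.IH[OF s] step.hyps by simp
qed

lemma tableaux_strict_mono:
  assumes "T \<in> tableaux n lam" "j \<in> {1..lam 1}"
  shows "strict_mono_on {1..zeta j} (T j)"
proof (rule strict_mono_onI)
  fix i k assume *: "i \<in> {1..zeta j}" "k \<in> {1..zeta j}" "i < k"
  then have "T j i + (k - i) \<le> T j k"
    using assms by (intro tableaux_column) (auto simp: shape_iff)
  then show "T j i < T j k" using * by simp
qed

lemma tableaux_row:
  "T \<in> tableaux n lam \<Longrightarrow> (j + 1, i) \<in> shape n lam \<Longrightarrow> 1 \<le> j \<Longrightarrow> T j i \<le> T (j + 1) i"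
  using zeta_antimono[of j "j + 1"] by (auto simp: tableaux_def shape_iff)

section \<open>Counting entries by value\<close>

definition tab_count :: "(nat \<Rightarrow> nat \<Rightarrow> nat) \<Rightarrow> nat set \<Rightarrow> nat" where
  "tab_count T A = card {(j, i) \<in> shape n lam. T j i \<in> A}"

lemma tab_count_columns: "tab_count T A = (\<Sum>j = 1..lam 1. card {i \<in> {1..zeta j}. T j i \<in> A})"
proof -
  have "{(j, i) \<in> shape n lam. T j i \<in> A}
      = Sigma {1..lam 1} (\<lambda>j. {i \<in> {1..zeta j}. T j i \<in> A})"
    by (auto simp: shape_iff)
  then show ?thesis by (simp add: tab_count_def)
qed

text \<open>Boxes are grouped by value. As the count depends on the content alone, equality of
  polynomials transfers it between tableaux, even of different shapes.\<close>

lemma tab_count_content: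
  assumes "finite A"
  shows "tab_count T A = (\<Sum>a\<in>A. content n lam T a)"
proof -
  let ?S = "{(j, i) \<in> shape n lam. T j i \<in> A}" and ?g = "\<lambda>(j, i). T j i"
  have fin: "finite ?S" by (rule finite_subset[OF _ finite_shape]) auto
  have "tab_count T A = (\<Sum>x\<in>?S. 1)" by (simp add: tab_count_def)
  also have "\<dots> = (\<Sum>a\<in>A. \<Sum>x\<in>{x \<in> ?S. ?g x = a}. 1)"
    by (rule sum.group[symmetric]) (use assms fin in auto)
  also have "\<dots> = (\<Sum>a\<in>A. content n lam T a)"
  proof (rule sum.cong[OF refl])
    fix a assume "a \<in> A"
    then have "{x \<in> ?S. ?g x = a} = {(j, i). (j, i) \<in> shape n lam \<and> T j i = a}" by auto
    then show "(\<Sum>x\<in>{x \<in> ?S. ?g x = a}. 1) = content n lam T a"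
      by (simp add: content_def)
  qed
  finally show ?thesis .
qed

text \<open>Boxes are grouped by value again; this excludes a strict entrywise inequality between
  tableaux of equal content.\<close>

lemma entry_sum_content:
  assumes "T \<in> tableaux n lam"
  shows "(\<Sum>(j, i)\<in>shape n lam. T j i) = (\<Sum>a = 1..n. a * content n lam T a)"
proof -
  let ?g = "\<lambda>(j, i). T j i"
  have "(\<Sum>a\<in>{1..n}. \<Sum>x\<in>{x \<in> shape n lam. ?g x = a}. ?g x) = (\<Sum>x\<in>shape n lam. ?g x)"
    by (rule sum.group) (use finite_shape tableaux_range[OF assms] in auto)
  moreover have "(\<Sum>x\<in>{x \<in> shape n lam. ?g x = a}. ?g x) = a * content n lam T a" for a
  proof -
    have "{x \<in> shape n lam. ?g x = a} = {(j, i). (j, i) \<in> shape n lam \<and> T j i = a}" by auto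
    moreover have "(\<Sum>x\<in>{x \<in> shape n lam. ?g x = a}. ?g x)
        = (\<Sum>x\<in>{x \<in> shape n lam. ?g x = a}. a)"
      by (rule sum.cong) auto
    ultimately show ?thesis by (simp add: content_def)
  qed
  ultimately show ?thesis by (simp only:)
qed

text \<open>Both sides count the boxes in the first \<open>k\<close> rows, by columns and by
  rows.\<close>

lemma sum_min_zeta:
  assumes "k \<le> n"
  shows "(\<Sum>j = 1..lam 1. min k (zeta j)) = (\<Sum>i = 1..k. lam i)"
proof -
  let ?R = "Sigma {1..k} (\<lambda>i. {1..lam i})"
  have "(\<Sum>j = 1..lam 1. min k (zeta j)) = card {(j, i) \<in> shape n lam. i \<le> k}"
  proof -
    have "{(j, i) \<in> shape n lam. i \<le> k} = Sigma {1..lam 1} (\<lambda>j. {i \<in> {1..zeta j}. i \<le> k})"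
      by (auto simp: shape_iff)
    then show ?thesis by (simp add: card_atMost_filter[simplified])
  qed
  also have "{(j, i) \<in> shape n lam. i \<le> k} = prod.swap ` ?R"
    using assms by (auto simp: shape_iff_row image_iff)
  also have "card \<dots> = card ?R"
    by (rule card_image) (simp add: inj_on_def)
  finally show ?thesis by simp
qed

lemma tableaux_column_card_le:
  assumes "T \<in> tableaux n lam" "j \<in> {1..lam 1}" "finite A"
  shows "card {i \<in> {1..zeta j}. T j i \<in> A} \<le> min (card A) (zeta j)"
proof -
  have "inj_on (T j) {i \<in> {1..zeta j}. T j i \<in> A}"
    by (rule inj_on_subset[OF strict_mono_on_imp_inj_on[OF tableaux_strict_mono[OF assms(1,2)]]]) auto
  then have "card {i \<in> {1..zeta j}. T j i \<in> A} \<le> card A"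
    by (rule card_inj_on_le) (use assms in auto)
  moreover have "card {i \<in> {1..zeta j}. T j i \<in> A} \<le> card {1..zeta j}"
    by (rule card_mono) auto
  ultimately show ?thesis by simp
qed

text \<open>By strictness, column \<open>j\<close> contributes at most
  \<open>min (card A) (zeta j)\<close>; these bounds add up to the number of boxes in the first
  \<open>card A\<close> rows.\<close>

lemma tab_count_le:
  assumes "T \<in> tableaux n lam" "A \<subseteq> {1..n}"
  shows "tab_count T A \<le> (\<Sum>i = 1..card A. lam i)"
proof -
  have "finite A" "card A \<le> n" using assms finite_subset card_mono[of "{1..n}" A] by auto
  then show ?thesis
    unfolding tab_count_columns sum_min_zeta[OF \<open>card A \<le> n\<close>, symmetric]
    by (intro sum_mono tableaux_column_card_le[OF assms(1)])
qed

lemma key_column_image: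
  assumes "\<pi> permutes {1..n}" "j \<in> {1..lam 1}"
  shows "key_tableau n lam \<pi> j ` {1..zeta j} = \<pi> ` {1..zeta j}"
proof -
  have "key_tableau n lam \<pi> j ` {1..zeta j} = elt (\<pi> ` {1..zeta j}) ` {1..zeta j}"
    by (rule image_cong) (use assms key_tableau_eq shape_iff in auto)
  then show ?thesis
    using elt_image[of "\<pi> ` {1..zeta j}"] card_perm_image[OF assms(1), of "{1..zeta j}"] by simp
qed

text \<open>Column \<open>j\<close> consists of the images of \<open>{1..zeta j}\<close> under the
  injective \<open>\<pi>\<close>, of which \<open>min k (zeta j)\<close> are images of
  \<open>{1..k}\<close>: every column attains its bound.\<close>

lemma tab_count_key:
  assumes "\<pi> permutes {1..n}" "k \<le> n"
  shows "tab_count (key_tableau n lam \<pi>) (\<pi> ` {1..k}) = (\<Sum>i = 1..k. lam i)"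
proof -
  let ?Y = "key_tableau n lam \<pi>"
  have "card {i \<in> {1..zeta j}. ?Y j i \<in> \<pi> ` {1..k}} = min k (zeta j)" if j: "j \<in> {1..lam 1}" for j
  proof -
    let ?I = "{i \<in> {1..zeta j}. ?Y j i \<in> \<pi> ` {1..k}}"
    have "inj_on (?Y j) ?I"
      by (rule inj_on_subset[OF strict_mono_on_imp_inj_on[OF
            tableaux_strict_mono[OF key_in_tableaux[OF assms(1)] j]]]) auto
    then have "card ?I = card (?Y j ` ?I)" by (simp only: card_image)
    also have "?Y j ` ?I = ?Y j ` {1..zeta j} \<inter> \<pi> ` {1..k}" by auto
    also have "\<dots> = \<pi> ` ({1..zeta j} \<inter> {1..k})"
      unfolding key_column_image[OF assms(1) j]
      by (rule image_Int[symmetric]) (rule permutes_inj[OF assms(1)])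
    also have "{1..zeta j} \<inter> {1..k} = {1..min k (zeta j)}" by auto
    finally show ?thesis using card_perm_image[OF assms(1), of "{1..min k (zeta j)}"] by simp
  qed
  then show ?thesis
    unfolding tab_count_columns sum_min_zeta[OF assms(2), symmetric] by (intro sum.cong refl)
qed

text \<open>The equality case of \<open>tab_count_le\<close>: a tableau whose content is the extremal weight
  of \<open>\<pi>\<close> must be the key.\<close>

lemma key_unique:
  assumes \<pi>: "\<pi> permutes {1..n}" and T: "T \<in> tableaux n lam"
    and count: "\<And>k. k \<le> n \<Longrightarrow> tab_count T (\<pi> ` {1..k}) = (\<Sum>i = 1..k. lam i)"
  shows "T = key_tableau n lam \<pi>"
proof (intro ext)
  fix j i
  show "T j i = key_tableau n lam \<pi> j i"
  proof (cases "(j, i) \<in> shape n lam")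
    case False
    then show ?thesis using tableaux_outside[OF T] by (simp add: key_tableau_def)
  next
    case True
    then have j: "j \<in> {1..lam 1}" and i: "i \<in> {1..zeta j}" by (auto simp: shape_iff)
    let ?B = "\<pi> ` {1..zeta j}"
    let ?c = "\<lambda>k. card {i \<in> {1..zeta k}. T k i \<in> ?B}"
    have cB: "card ?B = zeta j" using card_perm_image[OF \<pi>] by simp
    \<comment> \<open>The choice of as many values as column \<open>j\<close> has boxes makes the
      total attain the sum of the columnwise bounds. Each column then attains its own, so column
      \<open>j\<close> consists of these values.\<close>
    have "(\<Sum>k = 1..lam 1. ?c k) = (\<Sum>k = 1..lam 1. min (zeta j) (zeta k))"
      using count[OF zeta_le[of j]] by (simp only: tab_count_columns sum_min_zeta[OF zeta_le])
    then have "?c j = min (zeta j) (zeta j)"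
      by (rule sum_mono_inv) (use tableaux_column_card_le[OF T _, of _ ?B] cB j in auto)
    then have "{i \<in> {1..zeta j}. T j i \<in> ?B} = {1..zeta j}"
      by (intro card_subset_eq) auto
    then have "T j ` {1..zeta j} \<subseteq> ?B" by blast
    moreover have "card (T j ` {1..zeta j}) = card ?B"
      using cB strict_mono_on_imp_inj_on[OF tableaux_strict_mono[OF T j]] by (simp add: card_image)
    ultimately have "T j ` {1..zeta j} = ?B"
      by (intro card_subset_eq) auto
    from elt_unique[OF tableaux_strict_mono[OF T j] this i]
    show ?thesis using key_tableau_eq[OF \<pi> True] by simp
  qed
qed

text \<open>The smallest tableau of the shape. Its content is \<open>lam\<close> itself, which makes
  the shape visible in the polynomial.\<close>

definition row_tableau :: "nat \<Rightarrow> nat \<Rightarrow> nat" where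
  "row_tableau j i = (if (j, i) \<in> shape n lam then i else 0)"

lemma row_tableau_in_row_bound_set:
  assumes "\<beta> \<in> upper_tuples n"
  shows "row_tableau \<in> row_bound_set n lam \<beta>"
  using assms
  by (auto simp: row_bound_set_def tableaux_def row_tableau_def upper_tuples_def shape_iff_row)

lemma tab_count_row_tableau:
  assumes "k \<le> n"
  shows "tab_count row_tableau {1..k} = (\<Sum>i = 1..k. lam i)"
proof -
  have "{i \<in> {1..zeta j}. row_tableau j i \<in> {1..k}} = {i \<in> {1..zeta j}. i \<le> k}"
    if "j \<in> {1..lam 1}" for j
    using that by (auto simp: row_tableau_def shape_iff)
  then show ?thesis
    unfolding tab_count_columns sum_min_zeta[OF assms, symmetric]
    by (intro sum.cong refl) (simp only: card_atMost_filter)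
qed

lemma tableaux_le_antisym:
  assumes "T \<in> tableaux n lam" "T' \<in> tableaux n lam" "T \<le> T'"
    and "\<And>a. a \<in> {1..n} \<Longrightarrow> content n lam T a = content n lam T' a"
  shows "T = T'"
proof (intro ext)
  fix j i
  show "T j i = T' j i"
  proof (cases "(j, i) \<in> shape n lam")
    case True
    have "(\<Sum>(j, i)\<in>shape n lam. T j i) = (\<Sum>(j, i)\<in>shape n lam. T' j i)"
      using assms(4) by (simp add: entry_sum_content assms(1,2))
    then have "case_prod T (j, i) = case_prod T' (j, i)"
      by (rule sum_mono_inv) (use True finite_shape assms(3) in \<open>auto simp: le_fun_def\<close>)
    then show ?thesis by simp
  next
    case False
    then show ?thesis using tableaux_outside assms(1,2) by metis
  qed
qed

end

section \<open>Coefficients of tableau polynomials\<close>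

definition content_exp :: "nat \<Rightarrow> (nat \<Rightarrow> nat) \<Rightarrow> (nat \<Rightarrow> nat \<Rightarrow> nat) \<Rightarrow> nat \<Rightarrow>\<^sub>0 nat" where
  "content_exp n lam T = (\<Sum>i = 1..n. Poly_Mapping.single i (content n lam T i))"

lemma X_power: "X i ^ k = Poly_Mapping.single (Poly_Mapping.single i k) 1"
  by (induction k) (auto simp: X_def mult_single simp flip: single_add)

lemma tab_monom_eq: "tab_monom n lam T = Poly_Mapping.single (content_exp n lam T) 1"
proof -
  have "(\<Prod>i\<in>A. X i ^ f i) = Poly_Mapping.single (\<Sum>i\<in>A. Poly_Mapping.single i (f i)) 1"
    if "finite A" for A f
    using that by (induction A rule: finite_induct) (auto simp: X_power mult_single)
  then show ?thesis by (simp add: tab_monom_def content_exp_def)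
qed

lemma lookup_content_exp:
  "i \<in> {1..n} \<Longrightarrow> Poly_Mapping.lookup (content_exp n lam T) i = content n lam T i"
  by (simp add: content_exp_def lookup_sum lookup_single when_def)

text \<open>Each tableau adds 1 at its own exponent vector. The equality of polynomials enters the
  argument only as equality of these cardinalities.\<close>

lemma lookup_sum_tab_monom:
  assumes "finite S"
  shows "Poly_Mapping.lookup (\<Sum>T\<in>S. tab_monom n lam T) m = int (card {T \<in> S. content_exp n lam T = m})"
  using assms
  by (simp add: tab_monom_eq lookup_sum lookup_single when_def sum.If_cases Int_def
      eq_commute[of _ m])

section \<open>Row bounds and cores\<close>

text \<open>Strictness down a column of length \<open>e\<close> makes the bounds of the rows below \<open>i\<close> bound row
  \<open>i\<close> as well.\<close>

definition col_bound :: "(nat \<Rightarrow> nat) \<Rightarrow> nat \<Rightarrow> nat \<Rightarrow> nat" where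
  "col_bound \<beta> e i = Min ((\<lambda>k. \<beta> k + i - k) ` {i..e})"

lemma upper_tuples_ge: "\<beta> \<in> upper_tuples n \<Longrightarrow> i \<in> {1..n} \<Longrightarrow> i \<le> \<beta> i"
  by (simp add: upper_tuples_def)

lemma upper_tuples_le: "\<beta> \<in> upper_tuples n \<Longrightarrow> i \<in> {1..n} \<Longrightarrow> \<beta> i \<le> n"
  by (auto simp: upper_tuples_def)

text \<open>As \<open>k \<le> \<beta> k\<close> for an upper tuple, the subtraction in
  \<open>col_bound\<close> is never truncated.\<close>

lemma le_col_bound_iff:
  assumes "\<beta> \<in> upper_tuples n" "1 \<le> i" "i \<le> e" "e \<le> n"
  shows "v \<le> col_bound \<beta> e i \<longleftrightarrow> (\<forall>k\<in>{i..e}. v + k \<le> \<beta> k + i)"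
proof -
  have "v \<le> col_bound \<beta> e i \<longleftrightarrow> (\<forall>k\<in>{i..e}. v \<le> \<beta> k + i - k)"
    unfolding col_bound_def using assms(3) by (subst Min_ge_iff) auto
  also have "\<dots> \<longleftrightarrow> (\<forall>k\<in>{i..e}. v + k \<le> \<beta> k + i)"
  proof (intro ball_cong refl)
    fix k assume "k \<in> {i..e}"
    then have "k \<le> \<beta> k" using assms by (intro upper_tuples_ge[OF assms(1)]) auto
    then show "v \<le> \<beta> k + i - k \<longleftrightarrow> v + k \<le> \<beta> k + i" by auto
  qed
  finally show ?thesis .
qed

lemma col_bound_le:
  assumes "\<beta> \<in> upper_tuples n" "1 \<le> i" "e \<le> n" "k \<in> {i..e}"
  shows "col_bound \<beta> e i + k \<le> \<beta> k + i"
  using le_col_bound_iff[OF assms(1,2) _ assms(3), of "col_bound \<beta> e i"] assms(4) by auto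

lemma col_bound_ge:
  assumes "\<beta> \<in> upper_tuples n" "1 \<le> i" "i \<le> e" "e \<le> n"
  shows "i \<le> col_bound \<beta> e i"
  using assms upper_tuples_ge[OF assms(1)] by (subst le_col_bound_iff[OF assms]) auto

text \<open>The index \<open>x\<close> minimizes \<open>\<beta> k - k\<close>, hence also
  \<open>\<beta> k + i - k\<close>.\<close>

lemma col_bound_eqI:
  assumes "\<beta> \<in> upper_tuples n" "1 \<le> i" "e \<le> n" "x \<in> {i..e}"
    and "\<And>k. k \<in> {i..e} \<Longrightarrow> \<beta> x + k \<le> \<beta> k + x"
  shows "col_bound \<beta> e i = \<beta> x - (x - i)"
proof (rule antisym)
  have x: "x \<le> \<beta> x" using assms by (intro upper_tuples_ge) auto
  show "col_bound \<beta> e i \<le> \<beta> x - (x - i)" using col_bound_le[OF assms(1-4)] assms(4) by auto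
  have "\<forall>k\<in>{i..e}. \<beta> x - (x - i) + k \<le> \<beta> k + i" using x assms(4,5) by force
  then show "\<beta> x - (x - i) \<le> col_bound \<beta> e i"
    using assms by (subst le_col_bound_iff[OF assms(1,2)]) auto
qed

context partition_shape
begin

section \<open>The maximum of a row bound set\<close>

definition max_tableau :: "(nat \<Rightarrow> nat) \<Rightarrow> nat \<Rightarrow> nat \<Rightarrow> nat" where
  "max_tableau \<beta> j i = (if (j, i) \<in> shape n lam then col_bound \<beta> (zeta j) i else 0)"

lemma max_tableau_le: "\<beta> \<in> upper_tuples n \<Longrightarrow> (j, i) \<in> shape n lam \<Longrightarrow> max_tableau \<beta> j i \<le> \<beta> i"
  using col_bound_le[of \<beta> n i "zeta j" i] zeta_le[of j] by (auto simp: max_tableau_def shape_iff)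

text \<open>Passing to the next row drops one bound and raises the others by 1, so columns are
  strict. Passing to the next column can only drop bounds, so rows are weak.\<close>

lemma max_tableau_in_tableaux:
  assumes \<beta>: "\<beta> \<in> upper_tuples n"
  shows "max_tableau \<beta> \<in> tableaux n lam"
proof -
  have "max_tableau \<beta> j i \<in> {1..n}" if "(j, i) \<in> shape n lam" for j i
  proof -
    have i: "i \<in> {1..n}" "i \<in> {1..zeta j}"
      using that zeta_le[of j] by (auto simp: shape_iff)
    have "max_tableau \<beta> j i \<le> n"
      using max_tableau_le[OF \<beta> that] upper_tuples_le[OF \<beta> i(1)] by simp
    moreover have "i \<le> max_tableau \<beta> j i"
      using col_bound_ge[OF \<beta>, of i "zeta j"] i(2) zeta_le[of j] that by (simp add: max_tableau_def)
    ultimately show ?thesis using i(1) by auto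
  qed
  moreover have "max_tableau \<beta> j i < max_tableau \<beta> j (i + 1)"
    if s: "(j, i) \<in> shape n lam" "(j, i + 1) \<in> shape n lam" for j i
  proof -
    have "Suc (col_bound \<beta> (zeta j) i) \<le> col_bound \<beta> (zeta j) (i + 1)"
      using s zeta_le[of j] col_bound_le[OF \<beta>, of i "zeta j"]
      by (subst le_col_bound_iff[OF \<beta>]) (auto simp: shape_iff)
    then show ?thesis using s by (simp add: max_tableau_def)
  qed
  moreover have "max_tableau \<beta> j i \<le> max_tableau \<beta> (j + 1) i"
    if s: "(j, i) \<in> shape n lam" "(j + 1, i) \<in> shape n lam" for j i
  proof -
    have "col_bound \<beta> (zeta j) i \<le> col_bound \<beta> (zeta (j + 1)) i"
      using s zeta_le[of j] zeta_le[of "j + 1"] zeta_antimono[of j "j + 1"]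
        col_bound_le[OF \<beta>, of i "zeta j"]
      by (subst le_col_bound_iff[OF \<beta>]) (auto simp: shape_iff)
    then show ?thesis using s by (simp add: max_tableau_def)
  qed
  ultimately show ?thesis by (auto simp: tableaux_def max_tableau_def)
qed

text \<open>Column strictness carries the bound of row \<open>k\<close> to row \<open>i\<close> with
  a loss of \<open>k - i\<close>; conversely, the term \<open>k = i\<close> gives back the row
  bound. Row bound sets are thus principal ideals among the tableaux.\<close>

lemma row_bound_set_iff:
  assumes \<beta>: "\<beta> \<in> upper_tuples n"
  shows "T \<in> row_bound_set n lam \<beta> \<longleftrightarrow> T \<in> tableaux n lam \<and> T \<le> max_tableau \<beta>"
proof (intro iffI conjI)
  assume "T \<in> row_bound_set n lam \<beta>"
  then have T: "T \<in> tableaux n lam" and le: "\<And>j i. (j, i) \<in> shape n lam \<Longrightarrow> T j i \<le> \<beta> i"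
    by (auto simp: row_bound_set_def)
  show "T \<in> tableaux n lam" by fact
  show "T \<le> max_tableau \<beta>"
  proof (intro le_funI)
    fix j i
    show "T j i \<le> max_tableau \<beta> j i"
    proof (cases "(j, i) \<in> shape n lam")
      case True
      have "T j i + k \<le> \<beta> k + i" if k: "k \<in> {i..zeta j}" for k
      proof -
        have "(j, k) \<in> shape n lam" using True k by (auto simp: shape_iff)
        from tableaux_column[OF T _ _ this, of i] le[OF this]
        show ?thesis using True k by (auto simp: shape_iff)
      qed
      then have "T j i \<le> col_bound \<beta> (zeta j) i"
        using True zeta_le[of j] by (subst le_col_bound_iff[OF \<beta>]) (auto simp: shape_iff)
      then show ?thesis using True by (simp add: max_tableau_def)
    qed (simp add: tableaux_outside[OF T])
  qed
next
  assume "T \<in> tableaux n lam \<and> T \<le> max_tableau \<beta>"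
  then show "T \<in> row_bound_set n lam \<beta>"
    using max_tableau_le[OF \<beta>]
    by (auto simp: row_bound_set_def le_fun_def) (meson order_trans)
qed

lemma Qmax_eq:
  assumes "\<beta> \<in> upper_tuples n"
  shows "Qmax n lam \<beta> = max_tableau \<beta>"
  unfolding Qmax_def
  by (rule Greatest_equality)
    (use row_bound_set_iff[OF assms] max_tableau_in_tableaux[OF assms] in auto)

section \<open>Critical indices and the core\<close>

lemma critical_cands_iff:
  "x \<in> critical_cands n lam \<upsilon> h y \<longleftrightarrow> qq (h - 1) < x \<and> x < y \<and> \<upsilon> x + y < \<upsilon> y + x"
  by (auto simp: critical_cands_def)

lemma finite_critical_cands: "finite (critical_cands n lam \<upsilon> h y)"
  by (rule finite_subset[of _ "{..<y}"]) (auto simp: critical_cands_iff)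

lemma Max_critical_cands:
  assumes "critical_cands n lam \<upsilon> h y \<noteq> {}"
  shows "Max (critical_cands n lam \<upsilon> h y) \<in> critical_cands n lam \<upsilon> h y"
    and "\<And>k. Max (critical_cands n lam \<upsilon> h y) < k \<Longrightarrow> k \<notin> critical_cands n lam \<upsilon> h y"
  using assms finite_critical_cands by (auto dest: Max_ge[OF finite_critical_cands])

lemma critical_in_carrel:
  assumes "x \<in> critical_in n lam \<upsilon> h" "h \<in> {1..Suc r}"
  shows "x \<in> carrel n lam h"
  using assms(1)
proof induction
  case first
  show ?case by (rule q_in_carrel) fact
next
  case (step x)
  then show ?case using Max_critical_cands(1)[of \<upsilon> h x]
    by (auto simp: critical_cands_iff carrel_iff)
qed

text \<open>Each step moves left to the nearest index with smaller \<open>\<upsilon> k - k\<close>.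
  Critical indices are thus the strict record minima of this difference when the carrel is read from
  its end.\<close>

lemma critical_in_suffix_min:
  assumes "x \<in> critical_in n lam \<upsilon> h" "k \<in> {x..qq h}"
  shows "\<upsilon> x + k \<le> \<upsilon> k + x"
  using assms
proof (induction arbitrary: k)
  case first
  then show ?case by simp
next
  case (step x)
  let ?m = "Max (critical_cands n lam \<upsilon> h x)"
  note m = Max_critical_cands[OF step.hyps(2)]
  show ?case
  proof (cases "k < x")
    case True
    with m(2)[of k] m(1) step.prems show ?thesis
      by (cases "k = ?m") (auto simp: critical_cands_iff)
  next
    case False
    with step.IH[of k] m(1) step.prems show ?thesis by (auto simp: critical_cands_iff)
  qed
qed

text \<open>The neighbour \<open>Suc x\<close> is the critical index \<open>y\<close> that produced
  \<open>x\<close>, or lies between the two and is no candidate. Either way its difference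
  \<open>\<upsilon> k - k\<close> is at least that of \<open>y\<close>, hence above that of
  \<open>x\<close>.\<close>

lemma critical_in_jump:
  assumes "x \<in> critical_in n lam \<upsilon> h" "x < qq h"
  shows "\<upsilon> x + 1 < \<upsilon> (Suc x)"
  using assms
proof cases
  case (step y)
  note m = Max_critical_cands[OF step(3), folded step(1)]
  from m(1) have "qq (h - 1) < x" "x < y" "\<upsilon> x + y < \<upsilon> y + x" by (auto simp: critical_cands_iff)
  then show ?thesis using m(2)[of "Suc x"] by (cases "Suc x = y") (auto simp: critical_cands_iff)
qed simp

text \<open>The minimum of \<open>\<beta> k - k\<close> over the rest of the carrel is attained at
  \<open>i\<close> if \<open>i\<close> is critical, and at the next critical index
  otherwise.\<close>

lemma core_eq_col_bound:
  assumes \<beta>: "\<beta> \<in> upper_tuples n" and h: "h \<in> {1..Suc r}" and i: "i \<in> carrel n lam h"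
  shows "core n lam \<beta> i = col_bound \<beta> (qq h) i"
proof -
  have in_h: "y \<in> critical_in n lam \<beta> h" if y: "y \<in> critical n lam \<beta>" "y \<in> carrel n lam h" for y
  proof -
    obtain h' where h': "h' \<in> {1..Suc r}" "y \<in> critical_in n lam \<beta> h'"
      using y(1) by (auto simp: critical_def)
    with carrel_unique[OF h'(1) h critical_in_carrel[OF h'(2,1)] y(2)] show ?thesis by simp
  qed
  have critI: "y \<in> critical n lam \<beta>" if "y \<in> critical_in n lam \<beta> h" for y
    using that h by (auto simp: critical_def)
  have i': "i \<in> {1..n}" "1 \<le> i" "i \<le> qq h" "qq h \<le> n"
    using carrel_subset[OF h i] i q_le[of h] h by (auto simp: carrel_iff)
  show ?thesis
  proof (cases "i \<in> critical n lam \<beta>")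
    case True
    have "col_bound \<beta> (qq h) i = \<beta> i - (i - i)"
      by (rule col_bound_eqI[OF \<beta>])
        (use i' critical_in_suffix_min[OF in_h[OF True i]] in auto)
    then show ?thesis using True i' by (simp add: core_def)
  next
    case False
    define x where "x = (LEAST x. x \<in> critical n lam \<beta> \<and> i < x)"
    have "qq h \<noteq> i" using False critI[OF critical_in.first] by auto
    then have ex: "qq h \<in> critical n lam \<beta> \<and> i < qq h"
      using critI[OF critical_in.first] i' by auto
    have x: "x \<in> critical n lam \<beta>" "i < x" "x \<le> qq h"
      using LeastI[of "\<lambda>x. x \<in> critical n lam \<beta> \<and> i < x", OF ex]
        Least_le[of "\<lambda>x. x \<in> critical n lam \<beta> \<and> i < x", OF ex] by (auto simp: x_def)
    have no: "y \<notin> critical n lam \<beta>" if "i \<le> y" "y < x" for y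
      using that False not_less_Least[of y "\<lambda>x. x \<in> critical n lam \<beta> \<and> i < x"]
      by (cases "i = y") (auto simp: x_def)
    have xh: "x \<in> critical_in n lam \<beta> h"
      using x i by (intro in_h) (auto simp: carrel_iff)
    \<comment> \<open>A candidate from \<open>i\<close> on would make the largest candidate a
      critical index in the range from \<open>i\<close> to \<open>x\<close>.\<close>
    have no_cand: "k \<notin> critical_cands n lam \<beta> h x" if "i \<le> k" for k
    proof
      assume k: "k \<in> critical_cands n lam \<beta> h x"
      then have ne: "critical_cands n lam \<beta> h x \<noteq> {}" by blast
      have "Max (critical_cands n lam \<beta> h x) \<in> critical n lam \<beta>"
        by (rule critI[OF critical_in.step[OF xh ne]])
      moreover have "k \<le> Max (critical_cands n lam \<beta> h x)"
        by (rule Max_ge[OF finite_critical_cands k])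
      ultimately show False
        using no[of "Max (critical_cands n lam \<beta> h x)"] that Max_critical_cands(1)[OF ne]
        by (auto simp: critical_cands_iff)
    qed
    have "\<beta> x + k \<le> \<beta> k + x" if "k \<in> {i..qq h}" for k
      using that i no_cand[of k] critical_in_suffix_min[OF xh, of k]
      by (cases "k < x") (auto simp: critical_cands_iff carrel_iff not_less)
    then have "col_bound \<beta> (qq h) i = \<beta> x - (x - i)"
      by (intro col_bound_eqI[OF \<beta>]) (use i' x in auto)
    then show ?thesis using False i' by (simp add: core_def x_def Let_def)
  qed
qed

text \<open>An upper tuple has \<open>\<beta> n = n\<close>, which forces these values. They are
  treated separately because, if \<open>lam n = 0\<close>, the rows of the last carrel have no boxes
  and no tableau shows them.\<close>

lemma core_last_carrel:
  assumes "\<beta> \<in> upper_tuples n" "i \<in> carrel n lam (Suc r)"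
  shows "core n lam \<beta> i = i"
proof -
  have i: "1 \<le> i" "i \<le> n" using carrel_subset[OF _ assms(2)] by auto
  have "\<beta> n = n"
    using upper_tuples_ge[OF assms(1), of n] upper_tuples_le[OF assms(1), of n] n_pos by simp
  then have "col_bound \<beta> n i \<le> i" using col_bound_le[OF assms(1), of i n n] i by auto
  moreover have "i \<le> col_bound \<beta> n i" using col_bound_ge[OF assms(1)] i by simp
  ultimately show ?thesis using core_eq_col_bound[OF assms(1) _ assms(2)] q_last by simp
qed

end

section \<open>Scanning\<close>

context partition_shape
begin

lemma scan_path_eq:
  assumes "j \<le> lam 1" "0 < u j"
  shows "scan_path lam T j u
    = ewis (\<lambda>k. T k (u k)) (j # filter (\<lambda>k. 0 < u k) [Suc j..<lam 1 + 1])"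
proof -
  have "[j..<lam 1 + 1] = j # [Suc j..<lam 1 + 1]" using assms by (intro upt_conv_Cons) auto
  then show ?thesis using assms by (simp only: scan_path_def filter.simps if_True)
qed

lemma scan_path_subset: "k \<in> set (scan_path lam T j u) \<Longrightarrow> j \<le> k \<and> k \<le> lam 1 \<and> 0 < u k"
  using set_ewis_subset[of "\<lambda>k. T k (u k)" "filter (\<lambda>k. 0 < u k) [j..<lam 1 + 1]"]
  by (auto simp: scan_path_def)

text \<open>Column \<open>j\<close> starts every path and so loses its lowest unmarked box in every
  round.\<close>

lemma scan_state_self:
  assumes "j \<le> lam 1" "t \<le> zeta j"
  shows "scan_state n lam T j t j = zeta j - t"
  using assms(2)
proof (induction t)
  case (Suc t)
  then have "j \<in> set (scan_path lam T j (scan_state n lam T j t))"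
    by (subst scan_path_eq) (use assms in auto)
  with Suc show ?case by (simp add: Let_def)
qed simp

text \<open>Along a path the values increase weakly from \<open>T j i\<close> to the scanned value,
  so they are all equal if these two are.\<close>

lemma scan_path_constant:
  assumes s: "(j, i) \<in> shape n lam" and eq: "scanning_tableau n lam T j i = T j i"
    and k: "k \<in> set (scan_path lam T j (scan_state n lam T j (zeta j - i)))"
  shows "T k (scan_state n lam T j (zeta j - i) k) = T j i"
proof -
  let ?u = "scan_state n lam T j (zeta j - i)"
  let ?L = "j # filter (\<lambda>k. 0 < ?u k) [Suc j..<lam 1 + 1]"
  have u: "?u j = i" "j \<le> lam 1" "0 < i"
    using scan_state_self[of j "zeta j - i"] s by (auto simp: shape_iff)
  then have path: "scan_path lam T j ?u = ewis (\<lambda>k. T k (?u k)) ?L"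
    by (intro scan_path_eq) auto
  have "T j i \<le> T k (?u k)"
    using head_le_ewis[of k "\<lambda>k. T k (?u k)" j] k u(1) unfolding path by simp
  moreover have "T k (?u k) \<le> T (last (scan_path lam T j ?u)) (?u (last (scan_path lam T j ?u)))"
    using ewis_le_last[of k "\<lambda>k. T k (?u k)" ?L] k by (simp only: path)
  then have "T k (?u k) \<le> scanning_tableau n lam T j i"
    using s by (simp add: scanning_tableau_def Let_def)
  ultimately show ?thesis using eq by simp
qed

text \<open>The path that fills a box starts at that box and increases weakly.\<close>

lemma le_scanning_tableau:
  assumes "T \<in> tableaux n lam"
  shows "T \<le> scanning_tableau n lam T"
proof (intro le_funI)
  fix j i
  show "T j i \<le> scanning_tableau n lam T j i"
  proof (cases "(j, i) \<in> shape n lam")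
    case True
    let ?u = "scan_state n lam T j (zeta j - i)"
    have u: "?u j = i" "j \<le> lam 1" "0 < i"
      using scan_state_self[of j "zeta j - i"] True by (auto simp: shape_iff)
    let ?L = "j # filter (\<lambda>k. 0 < ?u k) [Suc j..<lam 1 + 1]"
    have path: "scan_path lam T j ?u = ewis (\<lambda>k. T k (?u k)) ?L"
      by (rule scan_path_eq) (use u in auto)
    have "last (ewis (\<lambda>k. T k (?u k)) ?L) \<in> set (ewis (\<lambda>k. T k (?u k)) ?L)"
      by (rule last_in_set) simp
    from head_le_ewis[OF this] show ?thesis
      using True u(1) by (simp add: scanning_tableau_def Let_def path)
  qed (simp add: tableaux_outside[OF assms])
qed

text \<open>The column sets of a key are nested, so the head of each path is the largest unmarked
  entry from column \<open>j\<close> on. The path collects its ties and ends in the value of its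
  head.\<close>

lemma scanning_key_le:
  assumes \<pi>: "\<pi> permutes {1..n}"
  shows "scanning_tableau n lam (key_tableau n lam \<pi>) \<le> key_tableau n lam \<pi>"
proof (intro le_funI)
  fix j i
  let ?Y = "key_tableau n lam \<pi>"
  let ?C = "\<lambda>k. \<pi> ` {1..zeta k}"
  let ?u = "scan_state n lam ?Y j"
  \<comment> \<open>The head of round \<open>t\<close>, with rounds counted from 0.\<close>
  define v where "v t = elt (?C j) (zeta j - t)" for t
  have card_C: "card (?C k) = zeta k" for k
    using card_perm_image[OF \<pi>, of "{1..zeta k}"] by simp
  show "scanning_tableau n lam ?Y j i \<le> ?Y j i"
  proof (cases "(j, i) \<in> shape n lam")
    case False
    then show ?thesis by (simp add: scanning_tableau_def)
  next
    case True
    then have j: "1 \<le> j" "j \<le> lam 1" by (auto simp: shape_iff)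
    have Y: "?Y k l = elt (?C k) l" if "j \<le> k" "k \<le> lam 1" "1 \<le> l" "l \<le> zeta k" for k l
      using that j by (intro key_tableau_eq[OF \<pi>]) (auto simp: shape_iff)
    have value_le: "?Y k (?u t k) \<le> v t" and value_in: "?Y k (?u t k) \<in> ?C k"
      if "?u t k = card {x \<in> ?C k. x \<le> v t}" "j \<le> k" "k \<le> lam 1" "0 < ?u t k" for k t
    proof -
      have le: "?u t k \<le> card (?C k)" unfolding that(1) by (rule card_mono) auto
      then have "?Y k (?u t k) = elt (?C k) (?u t k)" using that card_C by (intro Y) auto
      moreover have "elt (?C k) (?u t k) \<le> v t"
        using that le by (subst elt_le_iff) auto
      moreover have "elt (?C k) (?u t k) \<in> ?C k"
        using that le by (intro elt_in) auto
      ultimately show "?Y k (?u t k) \<le> v t" "?Y k (?u t k) \<in> ?C k" by auto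
    qed
    text \<open>After each round, exactly the entries above the current entry of column \<open>j\<close> have
      been marked.\<close>
    have state: "\<forall>k. j \<le> k \<and> k \<le> lam 1 \<longrightarrow> ?u t k = card {x \<in> ?C k. x \<le> v t}"
      if "t < zeta j" for t
      using that
    proof (induction t)
      case 0
      show ?case
      proof (intro allI impI)
        fix k assume k: "j \<le> k \<and> k \<le> lam 1"
        have "x \<le> v 0" if x: "x \<in> ?C k" for x
        proof -
          have "x \<in> ?C j" using x zeta_antimono[of j k] k by auto
          then have "x \<in> elt (?C j) ` {1..card (?C j)}" by (subst elt_image) auto
          then obtain l where "l \<in> {1..zeta j}" "x = elt (?C j) l" unfolding card_C by auto
          then show ?thesis using 0 card_C[of j] by (simp add: v_def elt_le_elt_iff)
        qed
        then have "{x \<in> ?C k. x \<le> v 0} = ?C k" by auto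
        then show "?u 0 k = card {x \<in> ?C k. x \<le> v 0}" using card_C by simp
      qed
    next
      case (Suc t)
      then have t: "t < zeta j"
        and IH: "\<And>k. j \<le> k \<Longrightarrow> k \<le> lam 1 \<Longrightarrow> ?u t k = card {x \<in> ?C k. x \<le> v t}" by auto
      let ?w = "\<lambda>k. ?Y k (?u t k)"
      let ?L = "filter (\<lambda>k. 0 < ?u t k) [Suc j..<lam 1 + 1]"
      have uj: "?u t j = zeta j - t" using scan_state_self[of j t] j t by simp
      then have wj: "?w j = v t" using t j Y[of j "zeta j - t"] by (simp add: v_def)
      have path: "scan_path lam ?Y j (?u t) = ewis ?w (j # ?L)"
        by (rule scan_path_eq) (use j uj t in auto)
      have "\<forall>k\<in>set ?L. ?w k \<le> ?w j" using value_le IH wj by auto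
      from set_ewis_max_head[OF this]
      have path_set: "set (scan_path lam ?Y j (?u t)) = {k \<in> set (j # ?L). ?w k = v t}"
        unfolding path wj .
      have L: "set (j # ?L) = {k. j \<le> k \<and> k \<le> lam 1 \<and> 0 < ?u t k}"
        using j uj t by (auto simp: Suc_le_eq)
      show ?case
      proof (intro allI impI)
        fix k assume k: "j \<le> k \<and> k \<le> lam 1"
        then have uk: "?u t k = card {x \<in> ?C k. x \<le> v t}" using IH by auto
        have "k \<in> set (scan_path lam ?Y j (?u t)) \<longleftrightarrow> v t \<in> ?C k"
        proof
          assume "k \<in> set (scan_path lam ?Y j (?u t))"
          then show "v t \<in> ?C k" using value_in[OF uk] k unfolding path_set L by auto
        next
          assume vt: "v t \<in> ?C k"
          have "{x \<in> ?C k. x \<le> v t} \<noteq> {}" using vt by blast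
          moreover have "finite {x \<in> ?C k. x \<le> v t}" by (intro finite_Collect_conjI) simp
          ultimately have pos: "0 < ?u t k" unfolding uk by (simp only: card_gt_0_iff simp_thms)
          have "?u t k \<le> card (?C k)" unfolding uk by (rule card_mono) auto
          then have "?u t k \<le> zeta k" by (simp only: card_C)
          then have "?w k = elt (?C k) (?u t k)" using pos k by (intro Y) auto
          also have "\<dots> = v t" unfolding uk using vt by (intro elt_card_le) auto
          finally show "k \<in> set (scan_path lam ?Y j (?u t))"
            using pos k unfolding path_set L by simp
        qed
        then have "?u (Suc t) k = card ({x \<in> ?C k. x \<le> v t} - {v t})"
          using uk by (auto simp: Let_def)
        \<comment> \<open>\<open>v (Suc t)\<close> is the next smaller element of column
          \<open>j\<close>, and every element of column \<open>k\<close> occurs in column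
          \<open>j\<close>.\<close>
        also have "{x \<in> ?C k. x \<le> v t} - {v t} = {x \<in> ?C k. x \<le> v (Suc t)}"
        proof -
          have "x \<le> v t \<and> x \<noteq> v t \<longleftrightarrow> x \<le> v (Suc t)" if x: "x \<in> ?C k" for x
          proof -
            have "x \<in> ?C j" using x zeta_antimono[of j k] k by auto
            then have "x \<in> elt (?C j) ` {1..card (?C j)}" by (subst elt_image) auto
            then obtain l where "l \<in> {1..zeta j}" "x = elt (?C j) l" unfolding card_C by auto
            then have "x < v t \<longleftrightarrow> l < zeta j - t" "x \<le> v (Suc t) \<longleftrightarrow> l \<le> zeta j - Suc t"
              unfolding v_def using Suc.prems card_C[of j] by (simp_all add: elt_less_iff elt_le_elt_iff)
            then show ?thesis using Suc.prems by auto
          qed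
          then show ?thesis by auto
        qed
        finally show "?u (Suc t) k = card {x \<in> ?C k. x \<le> v (Suc t)}" .
      qed
    qed
    let ?t = "zeta j - i"
    have t: "?t < zeta j" "zeta j - ?t = i" using True by (auto simp: shape_iff)
    let ?P = "scan_path lam ?Y j (?u ?t)"
    have "?u ?t j = i" using scan_state_self[of j ?t] j t by simp
    then have "?P \<noteq> []" using scan_path_eq[of j "?u ?t" ?Y] j t True by (simp add: shape_iff)
    then have "last ?P \<in> set ?P" by simp
    from scan_path_subset[OF this]
    have "?Y (last ?P) (?u ?t (last ?P)) \<le> v ?t" using state[OF t(1)] by (intro value_le) auto
    also have "\<dots> = ?Y j i" using key_tableau_eq[OF \<pi> True] t by (simp add: v_def)
    finally show ?thesis using True by (simp add: scanning_tableau_def Let_def)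
  qed
qed

text \<open>The paths started in column \<open>j\<close> exhaust column \<open>j + 1\<close>, and a path that ends in its
  initial value is constant.\<close>

lemma scanning_fixed_column_subset:
  assumes T: "T \<in> tableaux n lam" and j: "1 \<le> j" "j + 1 \<le> lam 1"
    and fixed: "\<And>i. i \<in> {1..zeta j} \<Longrightarrow> scanning_tableau n lam T j i = T j i"
  shows "T (j + 1) ` {1..zeta (j + 1)} \<subseteq> T j ` {1..zeta j}"
proof -
  let ?u = "scan_state n lam T j"
  \<comment> \<open>The second part says that the marked entries of the next column occur in column
    \<open>j\<close>. At \<open>t = zeta j\<close> the first part leaves none unmarked.\<close>
  have "?u t (j + 1) \<le> zeta j - t \<and>
      (\<forall>i. ?u t (j + 1) < i \<and> i \<le> zeta (j + 1) \<longrightarrow> T (j + 1) i \<in> T j ` {1..zeta j})"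
    if "t \<le> zeta j" for t
    using that
  proof (induction t)
    case 0
    then show ?case using zeta_antimono[of j "j + 1"] by simp
  next
    case (Suc t)
    let ?i = "zeta j - t"
    let ?P = "scan_path lam T j (?u t)"
    have i: "?i \<in> {1..zeta j}" "zeta j - ?i = t" using Suc.prems by auto
    then have s: "(j, ?i) \<in> shape n lam" using j by (auto simp: shape_iff)
    have IH: "?u t (j + 1) \<le> ?i"
      "\<And>l. ?u t (j + 1) < l \<Longrightarrow> l \<le> zeta (j + 1) \<Longrightarrow> T (j + 1) l \<in> T j ` {1..zeta j}"
      using Suc by auto
    show ?case
    proof (cases "j + 1 \<in> set ?P")
      case True
      then have pos: "0 < ?u t (j + 1)" using scan_path_subset by blast
      have "T (j + 1) (?u t (j + 1)) = T j ?i"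
        using scan_path_constant[OF s fixed[OF i(1)], of "j + 1"] True unfolding i(2) by simp
      then have "T (j + 1) l \<in> T j ` {1..zeta j}"
        if "?u t (j + 1) - 1 < l" "l \<le> zeta (j + 1)" for l
        using IH(2)[of l] that i(1) by (cases "l = ?u t (j + 1)") auto
      then show ?thesis using True IH(1) pos by (simp add: Let_def)
    next
      case False
      \<comment> \<open>Otherwise the box read right after the head lies in the same row and has at
        least its value, so the path would take it.\<close>
      have "?u t (j + 1) \<noteq> ?i"
      proof
        assume eq: "?u t (j + 1) = ?i"
        have uj: "?u t j = ?i" using scan_state_self[of j t] j Suc.prems by simp
        have "?u t (j + 1) \<le> zeta (j + 1)"
        proof -
          have "?u t k \<le> zeta k" for t k
            by (induction t) (auto simp: Let_def intro: le_trans[OF diff_le_self])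
          then show ?thesis .
        qed
        then have "T j ?i \<le> T (j + 1) ?i"
          using eq i j by (intro tableaux_row[OF T]) (auto simp: shape_iff)
        moreover have "[Suc j..<lam 1 + 1] = Suc j # [Suc (Suc j)..<lam 1 + 1]"
          using j by (intro upt_conv_Cons) auto
        ultimately have "j + 1 \<in> set ?P"
          using eq uj i j by (subst scan_path_eq) (auto simp: not_less simp del: upt_Suc)
        with False show False by simp
      qed
      then show ?thesis using False IH by (simp add: Let_def)
    qed
  qed
  from this[of "zeta j"] show ?thesis by auto
qed

end

section \<open>Pattern avoidance and gapless tuples\<close>

context partition_shape
begin

lemma Psi_eq:
  assumes "\<pi> permutes {1..n}" "h \<in> {1..Suc r}" "i \<in> carrel n lam h"
  shows "Psi n lam \<pi> i = elt (\<pi> ` {1..qq h}) i"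
proof -
  have i: "i \<in> {1..n}" by (rule carrel_subset[OF assms(2,3)])
  then have "Psi n lam \<pi> i = dth_largest (qq h - i + 1) (\<pi> ` {1..qq h})"
    by (simp only: Psi_def restrict_apply' carrel_index_eq[OF assms(2,3)] Let_def)
  also have "\<dots> = elt (\<pi> ` {1..qq h}) i"
    by (rule dth_largest_eq_elt)
      (use i assms(3) card_perm_image[OF assms(1), of "{1..qq h}"] in \<open>auto simp: carrel_iff\<close>)
  finally show ?thesis .
qed

text \<open>For \<open>h \<le> r\<close> some column has length \<open>qq h\<close>, and its rows in
  carrel \<open>h\<close> show both tuples. On the last carrel both are the identity.\<close>

lemma core_eq_Psi:
  assumes \<beta>: "\<beta> \<in> upper_tuples n" and \<pi>: "\<pi> permutes {1..n}"
    and eq: "max_tableau \<beta> = key_tableau n lam \<pi>"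
  shows "core n lam \<beta> = Psi n lam \<pi>"
proof
  fix i
  show "core n lam \<beta> i = Psi n lam \<pi> i"
  proof (cases "i \<in> {1..n}")
    case False
    then show ?thesis unfolding core_def Psi_def by (simp only: restrict_apply if_False)
  next
    case True
    then obtain h where h: "h \<in> {1..Suc r}" "i \<in> carrel n lam h" by (rule carrel_cases)
    show ?thesis
    proof (cases "h = Suc r")
      case last: True
      have "Psi n lam \<pi> i = elt {1..n} i"
        using Psi_eq[OF \<pi> h] last q_last permutes_image[OF \<pi>] by simp
      then show ?thesis
        using core_last_carrel[OF \<beta>] h last elt_atLeastAtMost[OF True] by simp
    next
      case False
      then have "h \<in> {1..r}" using h by auto
      from q_in_Rset[OF this] obtain j where j: "1 \<le> j" "j \<le> lam 1" "zeta j = qq h"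
        by (auto simp: Rset_def)
      have s: "(j, i) \<in> shape n lam" using j True h(2) by (auto simp: shape_iff carrel_iff)
      then have "col_bound \<beta> (qq h) i = max_tableau \<beta> j i" using j by (simp add: max_tableau_def)
      also have "\<dots> = elt (\<pi> ` {1..qq h}) i" unfolding eq key_tableau_eq[OF \<pi> s] j(3) ..
      finally show ?thesis using core_eq_col_bound[OF \<beta> h] Psi_eq[OF \<pi> h] by simp
    qed
  qed
qed

text \<open>Given a pattern \<open>\<pi> b < \<pi> c < \<pi> a\<close>, lower the first column of length \<open>q\<^sub>h\<close> of the key by
  exchanging \<open>\<pi> a\<close> for \<open>\<pi> c\<close>. The entry \<open>\<pi> c\<close> is then scanned into the preceding column,
  where the key does not have it.\<close>

lemma principal_imp_312_avoiding:
  assumes \<pi>: "\<pi> permutes {1..n}"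
    and principal: "\<And>T. T \<in> tableaux n lam \<Longrightarrow> T \<le> key_tableau n lam \<pi> \<Longrightarrow>
      scanning_tableau n lam T \<le> key_tableau n lam \<pi>"
  shows "lam_312_avoiding n lam \<pi>"
proof
  assume "lam_312_containing n lam \<pi>"
  then obtain h a b c where h: "h \<in> {1..r - 1}"
    and abc: "1 \<le> a" "a \<le> qq h" "qq h < b" "b \<le> qq (Suc h)" "qq (Suc h) < c" "c \<le> n"
      "\<pi> b < \<pi> c" "\<pi> c < \<pi> a"
    unfolding lam_312_containing_def by auto
  have hr: "h \<in> {1..r}" "Suc h \<in> {1..r}" using h by auto
  \<comment> \<open>\<open>J\<close> is the last column of length \<open>qq (Suc h)\<close> and
    \<open>J + 1\<close> the first of length \<open>qq h\<close>; both exist because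
    \<open>h < r\<close>.\<close>
  define J where "J = lam (qq (Suc h))"
  have J: "1 \<le> J" "zeta J = qq (Suc h)" and J1: "J + 1 \<le> lam 1" "zeta (J + 1) = qq h"
  proof -
    show "1 \<le> J" "zeta J = qq (Suc h)"
      using lam_q_less[OF hr(2)] zeta_eq_q_iff[OF hr(2), of J] by (auto simp: J_def)
    have *: "J + 1 \<le> lam (qq h)" using lam_q_less[OF hr(1)] by (simp add: J_def)
    also have "\<dots> \<le> lam 1" using q_pos[of h] q_le[of h] hr by (intro lam_antimono) auto
    finally show "J + 1 \<le> lam 1" .
    show "zeta (J + 1) = qq h" using zeta_eq_q_iff[OF hr(1), of "J + 1"] * by (simp add: J_def)
  qed
  let ?Y = "key_tableau n lam \<pi>"
  let ?B = "\<pi> ` {1..qq h}" and ?B2 = "\<pi> ` {1..qq (Suc h)}"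
  let ?B' = "insert (\<pi> c) (?B - {\<pi> a})"
  have inj: "\<pi> x = \<pi> y \<longleftrightarrow> x = y" for x y using permutes_inj[OF \<pi>] by (auto dest: injD)
  have qn: "qq h \<le> n" "qq h < qq (Suc h)" using q_le[of h] q_strict_mono[of h "Suc h"] hr by auto
  have card_B: "card ?B = qq h" using card_perm_image[OF \<pi>, of "{1..qq h}"] by simp
  have aB: "\<pi> a \<in> ?B" and bB: "\<pi> b \<notin> ?B" and cB: "\<pi> c \<notin> ?B"
    and bB2: "\<pi> b \<in> ?B2" and cB2: "\<pi> c \<notin> ?B2"
    using abc qn by (auto simp: inj)
  have card_B': "card ?B' = qq h" using aB cB card_B abc by (simp add: card_Diff_singleton)
  have B'_le: "elt ?B' i \<le> elt ?B i" if "1 \<le> i" "i \<le> qq h" for i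
    using that aB cB card_B abc by (intro elt_exchange_le) auto
  \<comment> \<open>The lowered column must still dominate the column to its left. Lowering it
    further, from \<open>\<pi> c\<close> to \<open>\<pi> b\<close>, yields a subset of that column;
    here \<open>\<pi> b < \<pi> c\<close> enters.\<close>
  have B2_le: "elt ?B2 i \<le> elt ?B' i" if i: "1 \<le> i" "i \<le> qq h" for i
  proof -
    let ?B'' = "insert (\<pi> b) (?B' - {\<pi> c})"
    have "?B'' = insert (\<pi> b) (?B - {\<pi> a})" using cB by auto
    then have "?B'' \<subseteq> ?B2" using bB2 qn by auto
    moreover have "card ?B'' = qq h" using bB cB card_B' abc by (auto simp: card_Diff_singleton)
    ultimately have "elt ?B2 i \<le> elt ?B'' i" using i by (intro elt_mono) auto
    also have "\<dots> \<le> elt ?B' i"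
      by (rule elt_exchange_le) (use i bB abc card_B' in auto)
    finally show ?thesis .
  qed
  define T where "T j i = (if j = J + 1 then if i \<in> {1..qq h} then elt ?B' i else 0 else ?Y j i)"
    for j i
  have Y: "?Y \<in> tableaux n lam" by (rule key_in_tableaux[OF \<pi>])
  have YJ: "?Y J i = elt ?B2 i" if "i \<in> {1..qq h}" for i
    using that J J1 qn by (subst key_tableau_eq[OF \<pi>]) (auto simp: shape_iff)
  have YJ1: "?Y (J + 1) i = elt ?B i" if "i \<in> {1..qq h}" for i
    using that J1 by (subst key_tableau_eq[OF \<pi>]) (auto simp: shape_iff)
  have shape_J1: "(J + 1, i) \<in> shape n lam \<longleftrightarrow> i \<in> {1..qq h}" for i
    using J1 by (auto simp: shape_iff)
  have T_le: "T \<le> ?Y"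
  proof (intro le_funI)
    fix j i
    show "T j i \<le> ?Y j i" using YJ1[of i] B'_le[of i] by (auto simp: T_def)
  qed
  have T: "T \<in> tableaux n lam"
  proof -
    have "T j i \<in> {1..n}" if s: "(j, i) \<in> shape n lam" for j i
    proof (cases "j = J + 1")
      case True
      then have i: "i \<in> {1..qq h}" using s shape_J1 by auto
      have "elt ?B' i \<in> ?B'" using i card_B' by (intro elt_in) auto
      moreover have "?B' \<subseteq> {1..n}"
        using perm_image_subset[OF \<pi> qn(1)] permutes_in_image[OF \<pi>, of c] abc by auto
      ultimately show ?thesis using True i by (auto simp: T_def)
    next
      case False
      then show ?thesis using tableaux_range[OF Y s] by (simp add: T_def)
    qed
    moreover have "T j i = 0" if s: "(j, i) \<notin> shape n lam" for j i
      using s shape_J1[of i] tableaux_outside[OF Y s] by (auto simp: T_def)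
    moreover have "T j i < T j (i + 1)"
      if s: "(j, i) \<in> shape n lam" "(j, i + 1) \<in> shape n lam" for j i
    proof (cases "j = J + 1")
      case True
      then have "i \<in> {1..qq h}" "i + 1 \<in> {1..qq h}" using s shape_J1 by auto
      then show ?thesis using True card_B' by (auto simp: T_def intro!: elt_strict_mono)
    next
      case False
      then show ?thesis using Y s by (simp add: T_def tableaux_def)
    qed
    moreover have "T j i \<le> T (j + 1) i"
      if s: "(j, i) \<in> shape n lam" "(j + 1, i) \<in> shape n lam" for j i
    proof -
      have Yr: "?Y j i \<le> ?Y (j + 1) i" using Y s by (simp add: tableaux_def)
      consider "j = J" | "j = J + 1" | "j \<noteq> J" "j \<noteq> J + 1" by blast
      then show ?thesis
      proof cases
        case 1
        then have "i \<in> {1..qq h}" using s(2) shape_J1 by auto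
        then show ?thesis using 1 YJ[of i] B2_le[of i] by (simp add: T_def)
      next
        case 2
        then have "T (j + 1) i = ?Y (j + 1) i" by (simp add: T_def)
        then show ?thesis using le_funD[OF le_funD[OF T_le, of j], of i] Yr by simp
      next
        case 3
        then show ?thesis using Yr by (simp add: T_def)
      qed
    qed
    ultimately show ?thesis by (auto simp: tableaux_def)
  qed
  \<comment> \<open>In column \<open>J\<close> the tableau \<open>T\<close> agrees with the key, so
    the scanned column is squeezed between the two.\<close>
  have "scanning_tableau n lam T J i = T J i" for i
  proof (rule antisym)
    show "scanning_tableau n lam T J i \<le> T J i"
      using le_funD[OF le_funD[OF principal[OF T T_le], of J], of i] by (simp add: T_def)
    show "T J i \<le> scanning_tableau n lam T J i"
      by (rule le_funD[OF le_funD[OF le_scanning_tableau[OF T]]])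
  qed
  from scanning_fixed_column_subset[OF T J(1) J1(1) this]
  have "T (J + 1) ` {1..qq h} \<subseteq> T J ` {1..qq (Suc h)}" by (simp only: J J1)
  also have "T J ` {1..qq (Suc h)} = ?Y J ` {1..zeta J}" unfolding J(2) by (simp add: T_def)
  also have "\<dots> = ?B2" using key_column_image[OF \<pi>, of J] J J1 by simp
  finally have "T (J + 1) ` {1..qq h} \<subseteq> ?B2" .
  moreover have "T (J + 1) ` {1..qq h} = elt ?B' ` {1..qq h}"
    by (rule image_cong) (auto simp: T_def)
  moreover have "elt ?B' ` {1..qq h} = ?B'" using elt_image[of ?B'] card_B' by simp
  ultimately show False using cB2 by auto
qed

text \<open>Let the tuple drop from \<open>M\<close> to \<open>m\<close> at the end of carrel
  \<open>h\<close>. A value between them outside the first \<open>qq (Suc h)\<close> values of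
  \<open>\<pi>\<close> would complete a 312 pattern. So all of them belong to that set and are
  consecutive in its sorted order.\<close>

lemma Psi_gapless:
  assumes \<pi>: "\<pi> permutes {1..n}" and av: "lam_312_avoiding n lam \<pi>"
  shows "Psi n lam \<pi> \<in> gapless_tuples n lam"
proof -
  let ?g = "Psi n lam \<pi>"
  let ?B = "\<lambda>h. \<pi> ` {1..qq h}"
  have card_B: "card (?B h) = qq h" for h using card_perm_image[OF \<pi>, of "{1..qq h}"] by simp
  have bounds: "?g i \<in> {1..n} \<and> i \<le> ?g i" if "i \<in> {1..n}" for i
  proof -
    obtain h where h: "h \<in> {1..Suc r}" "i \<in> carrel n lam h" using \<open>i \<in> {1..n}\<close> by (rule carrel_cases)
    have i: "1 \<le> i" "i \<le> card (?B h)" using that h card_B by (auto simp: carrel_iff)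
    have sub: "?B h \<subseteq> {1..n}" using h q_le[of h] by (intro perm_image_subset[OF \<pi>]) auto
    have "elt {1..n} i \<le> elt (?B h) i" using sub i by (intro elt_mono) auto
    then show ?thesis
      using elt_in[of "?B h" i] i sub elt_atLeastAtMost[OF that] Psi_eq[OF \<pi> h] by auto
  qed
  have "?g \<in> {1..n} \<rightarrow>\<^sub>E {1..n}"
  proof (rule PiE_I)
    show "?g i = undefined" if "i \<notin> {1..n}" for i
      using that unfolding Psi_def by (simp only: restrict_apply if_False)
  qed (use bounds in auto)
  then have upper: "?g \<in> upper_tuples n" using bounds by (simp add: upper_tuples_def)
  have smono: "strict_mono_on (carrel n lam h) ?g" if h: "h \<in> {1..Suc r}" for h
  proof (rule strict_mono_onI)
    fix i k assume *: "i \<in> carrel n lam h" "k \<in> carrel n lam h" "i < k"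
    then show "?g i < ?g k"
      using Psi_eq[OF \<pi> h] card_B[of h]
      by (auto simp: carrel_iff intro!: elt_strict_mono)
  qed
  have gap: "?g (qq h) - ?g (qq h + 1) + 1 \<le> p n lam (h + 1) \<and>
      (\<forall>t\<in>{1..?g (qq h) - ?g (qq h + 1) + 1}.
        ?g (qq h + t) = ?g (qq h) - (?g (qq h) - ?g (qq h + 1) + 1) + t)"
    if h: "h \<in> {1..r}" and desc: "?g (qq h) > ?g (qq h + 1)" for h
  proof -
    define M m where "M = ?g (qq h)" and "m = ?g (qq h + 1)"
    let ?B1 = "?B h" and ?B2 = "?B (Suc h)"
    have hh: "h \<in> {1..Suc r}" "Suc h \<in> {1..Suc r}" using h by auto
    have qh: "1 \<le> qq h" "qq h < qq (Suc h)" "qq (Suc h) \<le> n"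
      using q_pos[of h] q_strict_mono[of h "Suc h"] q_le[of "Suc h"] h by auto
    have M: "M = elt ?B1 (qq h)" unfolding M_def by (rule Psi_eq[OF \<pi> hh(1) q_in_carrel[OF hh(1)]])
    have m: "m = elt ?B2 (qq h + 1)"
      unfolding m_def using Psi_eq[OF \<pi> hh(2) Suc_q_in_carrel[OF h]] by simp
    have MB: "M \<in> ?B1" unfolding M using qh card_B by (intro elt_in) auto
    have mB: "m \<in> ?B2" unfolding m using qh card_B by (intro elt_in) auto
    have sub: "?B1 \<subseteq> ?B2" using qh by auto
    have card_m: "card {x \<in> ?B2. x \<le> m} = qq h + 1"
      unfolding m using qh card_B by (intro card_le_elt) auto
    have run: "v \<in> ?B2" if v: "m \<le> v" "v \<le> M" for v
    proof (rule ccontr)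
      assume vB: "v \<notin> ?B2"
      have "m \<noteq> v" "v \<noteq> M" using vB mB MB sub by blast+
      then have v': "m < v" "v < M" using v by auto
      have "?B2 \<subseteq> {1..n}" by (rule perm_image_subset[OF \<pi> qh(3)])
      then have "m \<in> {1..n}" "M \<in> {1..n}" using mB MB sub by blast+
      then have "v \<in> {1..n}" using v' by auto
      then have "v \<in> \<pi> ` {1..n}" using permutes_image[OF \<pi>] by simp
      then obtain c where c: "c \<in> {1..n}" "v = \<pi> c" by blast
      have "c \<notin> {1..qq (Suc h)}" using vB c(2) by blast
      then have c': "qq (Suc h) < c" using c(1) by auto
      \<comment> \<open>For \<open>h = r\<close> the index \<open>c\<close> would exceed
        \<open>qq (Suc r) = n\<close>.\<close>
      have "h \<noteq> r" using c c' q_last by auto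
      then have hr: "h \<in> {1..r - 1}" using h by auto
      obtain a where a: "a \<in> {1..qq h}" "M = \<pi> a" using MB by blast
      \<comment> \<open>The larger set has \<open>qq h + 1\<close> elements up to \<open>m\<close>,
        one more than the smaller set can hold; a surplus one supplies \<open>b\<close>.\<close>
      have "\<not> {x \<in> ?B2. x \<le> m} \<subseteq> ?B1"
      proof
        assume "{x \<in> ?B2. x \<le> m} \<subseteq> ?B1"
        then have "card {x \<in> ?B2. x \<le> m} \<le> card ?B1" by (intro card_mono) auto
        then show False using card_m card_B by simp
      qed
      then obtain b where b: "b \<in> {1..qq (Suc h)}" "\<pi> b \<le> m" "\<pi> b \<notin> ?B1" by blast
      then have "b \<notin> {1..qq h}" by blast
      then have "qq h < b" using b(1) by auto
      then have "lam_312_containing n lam \<pi>"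
        unfolding lam_312_containing_def
        using hr a b c c' v' by (intro bexI[OF _ hr] exI[of _ a] exI[of _ b] exI[of _ c]) auto
      with av show False by simp
    qed
    have pos: "qq h + t \<le> qq (Suc h) \<and> elt ?B2 (qq h + t) = m + t - 1"
      if t: "1 \<le> t" "t \<le> M - m + 1" for t
    proof -
      let ?v = "m + t - 1"
      have vB: "?v \<in> ?B2" using t desc by (intro run) (auto simp: M_def m_def)
      have "{x \<in> ?B2. x \<le> ?v} = {x \<in> ?B2. x \<le> m} \<union> {m<..?v}"
        using t desc run by (auto simp: M_def m_def)
      also have "card \<dots> = card {x \<in> ?B2. x \<le> m} + card {m<..?v}"
        by (rule card_Un_disjoint) auto
      finally have c: "card {x \<in> ?B2. x \<le> ?v} = qq h + t" using card_m t by simp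
      have "card {x \<in> ?B2. x \<le> ?v} \<le> card ?B2" by (rule card_mono) auto
      then have "qq h + t \<le> qq (Suc h)" using c card_B[of "Suc h"] by simp
      moreover have "elt ?B2 (qq h + t) = ?v"
        using elt_card_le[OF _ vB] unfolding c by simp
      ultimately show ?thesis by simp
    qed
    have g: "?g (qq h + t) = m + t - 1" if t: "1 \<le> t" "t \<le> M - m + 1" for t
      using Psi_eq[OF \<pi> hh(2), of "qq h + t"] pos[OF t] t by (auto simp: carrel_iff)
    have mM: "m < M" using desc by (simp add: M_def m_def)
    have "M - m + 1 \<le> p n lam (h + 1)" using pos[of "M - m + 1"] by (auto simp: p_def)
    moreover have "?g (qq h + t) = M - (M - m + 1) + t" if "t \<in> {1..M - m + 1}" for t
    proof -
      have "1 \<le> m" using bounds[of "qq h + 1"] qh by (auto simp: m_def)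
      then show ?thesis using g[of t] that mM by auto
    qed
    ultimately show ?thesis unfolding M_def m_def by blast
  qed
  have inc: "?g \<in> upper_inc_tuples n lam" using upper smono by (simp add: upper_inc_tuples_def)
  show ?thesis
    unfolding gapless_tuples_def Let_def
    by (intro CollectI conjI[OF inc] ballI impI) (rule gap, assumption+)
qed

section \<open>The flag of a gapless tuple\<close>

definition first_critical :: "(nat \<Rightarrow> nat) \<Rightarrow> nat \<Rightarrow> nat" where
  "first_critical \<gamma> h = (LEAST x. x \<in> critical_in n lam \<gamma> h)"

text \<open>The construction of critical indices stops at the least one, so no index to its left in
  the carrel has a smaller \<open>\<gamma> k - k\<close>.\<close>

lemma first_critical:
  assumes "h \<in> {1..Suc r}"
  shows "first_critical \<gamma> h \<in> critical_in n lam \<gamma> h"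
    and "first_critical \<gamma> h \<in> carrel n lam h"
    and "\<And>i. i \<in> carrel n lam h \<Longrightarrow> i < first_critical \<gamma> h \<Longrightarrow>
      \<gamma> (first_critical \<gamma> h) + i \<le> \<gamma> i + first_critical \<gamma> h"
proof -
  let ?x = "first_critical \<gamma> h"
  show x: "?x \<in> critical_in n lam \<gamma> h"
    unfolding first_critical_def by (rule LeastI) (rule critical_in.first)
  then show "?x \<in> carrel n lam h" using assms by (rule critical_in_carrel)
  have empty: "critical_cands n lam \<gamma> h ?x = {}"
  proof (rule ccontr)
    assume ne: "critical_cands n lam \<gamma> h ?x \<noteq> {}"
    then have "?x \<le> Max (critical_cands n lam \<gamma> h ?x)"
      unfolding first_critical_def by (intro Least_le critical_in.step[OF x[unfolded first_critical_def]])
    then show False using Max_critical_cands(1)[OF ne] by (simp add: critical_cands_iff)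
  qed
  fix i assume i: "i \<in> carrel n lam h" "i < ?x"
  have "i \<notin> critical_cands n lam \<gamma> h ?x" unfolding empty by simp
  then show "\<gamma> ?x + i \<le> \<gamma> i + ?x" using i by (auto simp: critical_cands_iff carrel_iff)
qed

lemma Phi_apply:
  assumes "h \<in> {1..Suc r}" "i \<in> carrel n lam h"
  shows "Phi n lam \<gamma> i =
    (if 2 \<le> h \<and> i < first_critical \<gamma> h then max (\<gamma> (qq (h - 1))) (\<gamma> i) else \<gamma> i)"
proof -
  have "i \<in> {1..n}" by (rule carrel_subset[OF assms])
  moreover have "1 \<le> h - 1 \<longleftrightarrow> 2 \<le> h" "h - 1 + 1 = h" using assms(1) by auto
  ultimately show ?thesis
    unfolding Phi_def first_critical_def Let_def
    by (simp only: restrict_apply' carrel_index_eq[OF assms])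
qed

context
  fixes \<gamma>
  assumes gapless: "\<gamma> \<in> gapless_tuples n lam"
begin

lemma gapless_upper: "\<gamma> \<in> upper_tuples n"
  using gapless by (simp add: gapless_tuples_def upper_inc_tuples_def)

lemma gapless_mono:
  assumes "h \<in> {1..Suc r}" "i \<in> carrel n lam h" "k \<in> carrel n lam h" "i \<le> k"
  shows "\<gamma> i \<le> \<gamma> k"
proof -
  have "strict_mono_on (carrel n lam h) \<gamma>"
    using gapless assms(1) by (simp add: gapless_tuples_def upper_inc_tuples_def)
  from strict_mono_onD[OF this assms(2,3)] show ?thesis using assms(4) by (cases "i = k") auto
qed

text \<open>After a drop, gaplessness makes the entries climb by 1 until they regain
  \<open>\<gamma> (qq h)\<close>. A critical index before the end of the carrel is followed by a
  jump of at least 2, so none occurs before that point.\<close>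

lemma gapless_first_critical:
  assumes h: "h \<in> {1..r}"
  shows "\<gamma> (qq h) \<le> \<gamma> (first_critical \<gamma> (Suc h))"
proof -
  let ?x = "first_critical \<gamma> (Suc h)"
  have hh: "Suc h \<in> {1..Suc r}" using h by auto
  note x = first_critical[where \<gamma> = \<gamma>, OF hh]
  have x': "qq h < ?x" "?x \<le> qq (Suc h)" using x(2) by (auto simp: carrel_iff)
  show ?thesis
  proof (cases "\<gamma> (qq h) \<le> \<gamma> (qq h + 1)")
    case True
    also have "\<gamma> (qq h + 1) \<le> \<gamma> ?x"
      using gapless_mono[OF hh Suc_q_in_carrel[OF h] x(2)] x' by simp
    finally show ?thesis .
  next
    case False
    define s where "s = \<gamma> (qq h) - \<gamma> (qq h + 1) + 1"
    have s: "s \<le> p n lam (h + 1)" "\<And>t. t \<in> {1..s} \<Longrightarrow> \<gamma> (qq h + t) = \<gamma> (qq h) - s + t"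
      using gapless h False unfolding gapless_tuples_def s_def Let_def by auto
    have "1 \<le> \<gamma> (qq h + 1)"
      using upper_tuples_ge[OF gapless_upper carrel_subset[OF hh Suc_q_in_carrel[OF h]]] by simp
    then have s': "1 \<le> s" "s \<le> \<gamma> (qq h)" using False by (auto simp: s_def)
    have "qq h + s \<le> qq (Suc h)"
      using s(1) q_strict_mono[of h "Suc h"] h by (simp add: p_def)
    show ?thesis
    proof (cases "qq h + s \<le> ?x")
      case True
      have "\<gamma> (qq h) = \<gamma> (qq h + s)" using s(2)[of s] s' by simp
      also have "\<dots> \<le> \<gamma> ?x"
        by (rule gapless_mono[OF hh _ x(2) True])
          (use s' \<open>qq h + s \<le> qq (Suc h)\<close> in \<open>auto simp: carrel_iff\<close>)
      finally show ?thesis .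
    next
      case False
      then have "\<gamma> ?x + 1 < \<gamma> (Suc ?x)"
        using \<open>qq h + s \<le> qq (Suc h)\<close> by (intro critical_in_jump[OF x(1)]) auto
      moreover obtain t where t: "?x = qq h + t" using le_Suc_ex[OF less_imp_le[OF x'(1)]] by blast
      then have "\<gamma> (Suc ?x) = \<gamma> ?x + 1"
        using s(2)[of t] s(2)[of "Suc t"] x' False by auto
      ultimately show ?thesis by simp
    qed
  qed
qed

text \<open>From the first critical index on, the maximum is already
  \<open>\<gamma> i\<close>.\<close>

lemma Phi_eq_max:
  assumes "h \<in> {1..r}" "i \<in> carrel n lam (Suc h)"
  shows "Phi n lam \<gamma> i = max (\<gamma> (qq h)) (\<gamma> i)"
proof -
  have hh: "Suc h \<in> {1..Suc r}" using assms by auto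
  have "\<gamma> (qq h) \<le> \<gamma> i" if "first_critical \<gamma> (Suc h) \<le> i"
    using gapless_first_critical[OF assms(1)]
      gapless_mono[OF hh first_critical(2)[OF hh] assms(2) that] by simp
  then show ?thesis using Phi_apply[OF hh assms(2), of \<gamma>] assms(1) by (auto simp: not_less max_def)
qed

lemma le_Phi: "i \<in> {1..n} \<Longrightarrow> \<gamma> i \<le> Phi n lam \<gamma> i"
  by (erule carrel_cases) (simp add: Phi_apply)

lemma Phi_flag: "Phi n lam \<gamma> \<in> upper_flags n"
proof -
  let ?f = "Phi n lam \<gamma>"
  have range: "?f i \<in> {1..n}" and upper: "i \<le> ?f i" if i: "i \<in> {1..n}" for i
  proof -
    obtain h where h: "h \<in> {1..Suc r}" "i \<in> carrel n lam h" using i by (rule carrel_cases)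
    have "\<gamma> (qq (h - 1)) \<le> n" if "2 \<le> h"
      using that h q_pos[of "h - 1"] q_le[of "h - 1"] by (intro upper_tuples_le[OF gapless_upper]) auto
    then have "?f i \<le> n"
      using Phi_apply[OF h, of \<gamma>] upper_tuples_le[OF gapless_upper i] by auto
    moreover show "i \<le> ?f i" using le_Phi[OF i] upper_tuples_ge[OF gapless_upper i] by simp
    ultimately show "?f i \<in> {1..n}" using i by auto
  qed
  have mono_step: "?f i \<le> ?f (Suc i)" if i: "i \<in> {1..n}" "Suc i \<in> {1..n}" for i
  proof -
    obtain h where h: "h \<in> {1..Suc r}" "i \<in> carrel n lam h" using i(1) by (rule carrel_cases)
    show ?thesis
    proof (cases "Suc i \<in> carrel n lam h")
      case same: True
      have g: "\<gamma> i \<le> \<gamma> (Suc i)" by (rule gapless_mono[OF h same]) simp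
      show ?thesis
      proof (cases "h = 1")
        case True
        then show ?thesis using Phi_apply[OF h, of \<gamma>] Phi_apply[OF h(1) same, of \<gamma>] g by simp
      next
        case False
        then have "h - 1 \<in> {1..r}" "Suc (h - 1) = h" using h by auto
        then show ?thesis using Phi_eq_max[of "h - 1" i] Phi_eq_max[of "h - 1" "Suc i"] h same g by auto
      qed
    next
      case False
      then have iq: "i = qq h" using h(2) by (auto simp: carrel_iff)
      then have "h \<noteq> Suc r" using i(2) q_last by auto
      then have hr: "h \<in> {1..r}" using h by auto
      \<comment> \<open>At the end of a carrel no maximum is taken, and the value
        \<open>\<gamma> (qq h)\<close> there is a lower bound on the next carrel.\<close>
      have "\<not> qq h < first_critical \<gamma> h" using first_critical(2)[OF h(1), of \<gamma>] by (simp add: carrel_iff)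
      then have "?f i = \<gamma> (qq h)" using Phi_apply[OF h, of \<gamma>] iq by simp
      then show ?thesis using Phi_eq_max[OF hr Suc_q_in_carrel[OF hr]] iq by simp
    qed
  qed
  have "?f i \<le> ?f k" if "1 \<le> i" "i \<le> k" "k \<le> n" for i k
    using that(2,3)
  proof (induction rule: dec_induct)
    case (step k)
    then show ?case using \<open>1 \<le> i\<close> by (intro order_trans[OF step.IH mono_step]) auto
  qed simp
  moreover have "?f \<in> {1..n} \<rightarrow>\<^sub>E {1..n}"
  proof (rule PiE_I)
    show "?f i = undefined" if "i \<notin> {1..n}" for i
      using that unfolding Phi_def by (simp only: restrict_apply if_False)
  qed (use range in auto)
  ultimately show ?thesis
    using upper by (auto simp: upper_flags_def upper_tuples_def intro!: mono_onI)
qed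

text \<open>A tableau bounded by \<open>\<beta>\<close> is bounded by its core, hence by
  \<open>Phi\<close>. Conversely, \<open>Phi\<close> agrees with \<open>\<gamma>\<close> from the
  first critical index \<open>x\<close> on, and column strictness carries the bound back:
  \<open>T j i \<le> \<gamma> x - (x - i) \<le> \<gamma> i\<close>.\<close>

lemma row_bound_set_Phi:
  assumes \<beta>: "\<beta> \<in> upper_tuples n" and core: "core n lam \<beta> = \<gamma>"
  shows "row_bound_set n lam \<beta> = row_bound_set n lam (Phi n lam \<gamma>)"
proof -
  have core_le: "\<gamma> i \<le> \<beta> i" if "h \<in> {1..Suc r}" "i \<in> carrel n lam h" for h i
    using col_bound_le[OF \<beta>, of i "qq h" i] core_eq_col_bound[OF \<beta> that] core
      that q_le[of h] by (auto simp: carrel_iff)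
  have "T j i \<le> Phi n lam \<gamma> i"
    if T: "T \<in> row_bound_set n lam \<beta>" and s: "(j, i) \<in> shape n lam" for T j i
  proof -
    have i: "i \<in> {1..n}" using s by (simp add: shape_iff_row)
    then obtain h where h: "h \<in> {1..Suc r}" "i \<in> carrel n lam h" by (rule carrel_cases)
    note q = q_le_zeta[OF h s]
    have "T j i \<le> max_tableau \<beta> j i"
      using T row_bound_set_iff[OF \<beta>] by (auto dest: le_funD)
    also have "\<dots> = col_bound \<beta> (zeta j) i" using s by (simp add: max_tableau_def)
    also have "\<dots> \<le> col_bound \<beta> (qq h) i"
      using col_bound_le[OF \<beta>, of i "zeta j"] zeta_le[of j] q h i q_le[of h]
      by (subst le_col_bound_iff[OF \<beta>]) (auto simp: carrel_iff)
    also have "\<dots> = \<gamma> i" using core_eq_col_bound[OF \<beta> h] core by simp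
    also have "\<dots> \<le> Phi n lam \<gamma> i" by (rule le_Phi[OF i])
    finally show ?thesis .
  qed
  moreover have "T j i \<le> \<beta> i"
    if T: "T \<in> row_bound_set n lam (Phi n lam \<gamma>)" and s: "(j, i) \<in> shape n lam" for T j i
  proof -
    have Tt: "T \<in> tableaux n lam"
      and Tle: "\<And>j i. (j, i) \<in> shape n lam \<Longrightarrow> T j i \<le> Phi n lam \<gamma> i"
      using T by (auto simp: row_bound_set_def)
    have i: "i \<in> {1..n}" using s by (simp add: shape_iff_row)
    then obtain h where h: "h \<in> {1..Suc r}" "i \<in> carrel n lam h" by (rule carrel_cases)
    let ?x = "first_critical \<gamma> h"
    note x = first_critical[where \<gamma> = \<gamma>, OF h(1)]
    have "T j i \<le> \<gamma> i"
    proof (cases "i < ?x")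
      case False
      then show ?thesis using Tle[OF s] Phi_apply[OF h, of \<gamma>] by simp
    next
      case True
      have sx: "(j, ?x) \<in> shape n lam"
        using q_le_zeta[OF h s] x(2) s by (auto simp: shape_iff carrel_iff)
      have "T j i + (?x - i) \<le> T j ?x"
        using True i by (intro tableaux_column[OF Tt _ _ sx]) auto
      also have "\<dots> \<le> \<gamma> ?x" using Tle[OF sx] Phi_apply[OF h(1) x(2), of \<gamma>] by simp
      finally show ?thesis using x(3)[OF h(2) True] True by simp
    qed
    then show ?thesis using core_le[OF h] by simp
  qed
  ultimately show ?thesis by (auto simp: row_bound_set_def)
qed

end

section \<open>Coincidence for equal shapes\<close>

lemma row_bound_demazure_coincidence:
  assumes \<beta>: "\<beta> \<in> upper_tuples n" and \<pi>: "\<pi> permutes {1..n}"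
    and fibres: "\<And>m. card {T \<in> row_bound_set n lam \<beta>. content_exp n lam T = m}
      = card {T \<in> demazure_set n lam \<pi>. content_exp n lam T = m}"
  shows "Qmax n lam \<beta> = key_tableau n lam \<pi> \<and>
    core n lam \<beta> = Psi n lam \<pi> \<and>
    lam_312_avoiding n lam \<pi> \<and>
    row_bound_set n lam \<beta> = demazure_set n lam \<pi>"
proof -
  let ?S = "row_bound_set n lam \<beta>" and ?D = "demazure_set n lam \<pi>"
  let ?Y = "key_tableau n lam \<pi>" and ?Q = "max_tableau \<beta>"
  have fin: "finite {T \<in> ?S. P T}" "finite {T \<in> ?D. P T}" for P
    by (rule finite_subset[OF _ finite_tableaux]; auto simp: row_bound_set_def demazure_set_def)+
  have S: "T \<in> ?S \<longleftrightarrow> T \<in> tableaux n lam \<and> T \<le> ?Q" for T by (rule row_bound_set_iff[OF \<beta>])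
  have D: "T \<in> tableaux n lam \<and> T \<le> ?Y" if "T \<in> ?D" for T
    using that le_scanning_tableau[of T] by (auto simp: demazure_set_def)
  have YD: "?Y \<in> ?D" using key_in_tableaux[OF \<pi>] scanning_key_le[OF \<pi>] by (simp add: demazure_set_def)
  have "{T \<in> ?D. content_exp n lam T = content_exp n lam ?Y} \<noteq> {}" using YD by blast
  then have "{T \<in> ?S. content_exp n lam T = content_exp n lam ?Y} \<noteq> {}"
    using fin fibres[of "content_exp n lam ?Y"] by (metis card_eq_0_iff)
  then obtain T where T: "T \<in> ?S" "content_exp n lam T = content_exp n lam ?Y" by blast
  have "T = ?Y"
  proof (rule key_unique[OF \<pi>])
    show "T \<in> tableaux n lam" using T S by simp
    fix k assume k: "k \<le> n"
    have "tab_count T (\<pi> ` {1..k}) = tab_count ?Y (\<pi> ` {1..k})"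
      unfolding tab_count_content[OF finite_imageI[OF finite_atLeastAtMost]]
      using perm_image_subset[OF \<pi> k] T(2) lookup_content_exp
      by (intro sum.cong refl) (metis subsetD)
    then show "tab_count T (\<pi> ` {1..k}) = (\<Sum>i = 1..k. lam i)"
      using tab_count_key[OF \<pi> k] by simp
  qed
  then have YQ: "?Y \<le> ?Q" using T S by simp
  have QS: "?Q \<in> ?S" using S max_tableau_in_tableaux[OF \<beta>] by simp
  then have "{T \<in> ?S. content_exp n lam T = content_exp n lam ?Q} \<noteq> {}" by blast
  then have "{T \<in> ?D. content_exp n lam T = content_exp n lam ?Q} \<noteq> {}"
    using fin fibres[of "content_exp n lam ?Q"] by (metis card_eq_0_iff)
  then obtain T' where T': "T' \<in> ?D" "content_exp n lam T' = content_exp n lam ?Q" by blast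
  have "T' = ?Q"
    using D[OF T'(1)] YQ QS S T'(2) lookup_content_exp
    by (intro tableaux_le_antisym) (auto, metis)
  then have QY: "?Q = ?Y" using D[OF T'(1)] YQ by (auto intro: antisym)
  have "?D \<subseteq> ?S" using D S QY by auto
  moreover have "?S \<subseteq> ?D"
  proof
    fix T assume T: "T \<in> ?S"
    let ?m = "content_exp n lam T"
    \<comment> \<open>For each content, the fibre in \<open>?D\<close> is contained in the fibre in
      \<open>?S\<close> and has the same cardinality.\<close>
    have "{T \<in> ?D. content_exp n lam T = ?m} = {T \<in> ?S. content_exp n lam T = ?m}"
      using fin fibres[of ?m] \<open>?D \<subseteq> ?S\<close> by (intro card_subset_eq) auto
    then show "T \<in> ?D" using T by blast
  qed
  ultimately have SD: "?S = ?D" by simp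
  have "lam_312_avoiding n lam \<pi>"
  proof (rule principal_imp_312_avoiding[OF \<pi>])
    fix T assume "T \<in> tableaux n lam" "T \<le> ?Y"
    then have "T \<in> ?D" using S QY SD by simp
    then show "scanning_tableau n lam T \<le> ?Y" by (simp add: demazure_set_def)
  qed
  then show ?thesis using QY SD core_eq_Psi[OF \<beta> \<pi> QY] Qmax_eq[OF \<beta>] by simp
qed

end

section \<open>Comparison of shapes and conclusion\<close>

theorem theorem14p3:
  fixes n :: nat and lam lam' \<beta> \<pi> :: "nat \<Rightarrow> nat"
  assumes "1 \<le> n"
    and "lam \<in> partitions n" and "lam' \<in> partitions n"
    and "\<beta> \<in> upper_tuples n"
    and "\<pi> \<in> lam_permutations n lam'"
    and "row_bound_sum n lam \<beta> = demazure_poly n lam' \<pi>"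
  shows "Qmax n lam \<beta> = key_tableau n lam' \<pi> \<and>
    lam = lam' \<and>
    core n lam \<beta> = Psi n lam \<pi> \<and>
    lam_312_avoiding n lam \<pi> \<and>
    core n lam \<beta> \<in> gapless_tuples n lam \<and>
    \<beta> \<in> UGC n lam \<and>
    row_bound_sum n lam \<beta> \<in> flag_schur_polys n lam \<and>
    row_bound_set n lam \<beta> = demazure_set n lam \<pi> \<and>
    Phi n lam (core n lam \<beta>) \<in> upper_flags n \<and>
    row_bound_set n lam \<beta> = row_bound_set n lam (Phi n lam (core n lam \<beta>))"
proof -
  interpret L: partition_shape n lam by standard fact+
  interpret L': partition_shape n lam' by standard fact+
  let ?S = "row_bound_set n lam \<beta>" and ?D = "demazure_set n lam' \<pi>"
  note \<beta> = \<open>\<beta> \<in> upper_tuples n\<close>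
  have \<pi>: "\<pi> permutes {1..n}" using assms(5) by (simp add: lam_permutations_def)
  have finS: "finite ?S" and finD: "finite ?D"
    by (rule finite_subset[OF _ L.finite_tableaux], auto simp: row_bound_set_def)
      (rule finite_subset[OF _ L'.finite_tableaux], auto simp: demazure_set_def)
  have fin: "finite {T \<in> ?S. P T}" "finite {T \<in> ?D. P T}" for P
    using finS finD by simp_all
  have fibres: "card {T \<in> ?S. content_exp n lam T = m}
      = card {T \<in> ?D. content_exp n lam' T = m}" for m
    using lookup_sum_tab_monom[OF finS, of n lam m] lookup_sum_tab_monom[OF finD, of n lam' m]
      assms(6) by (simp add: row_bound_sum_def demazure_poly_def)
  \<comment> \<open>The row tableau of \<open>lam\<close> and the key of \<open>lam'\<close> attain
    the bound in \<open>tab_count_le\<close>. A tableau of equal content in the other shape turns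
    each into one of the two inequalities.\<close>
  have sums: "(\<Sum>i = 1..k. lam i) = (\<Sum>i = 1..k. lam' i)" if k: "k \<le> n" for k
  proof (rule antisym)
    have "{T \<in> ?S. content_exp n lam T = content_exp n lam L.row_tableau} \<noteq> {}"
      using L.row_tableau_in_row_bound_set[OF \<beta>] by blast
    then have "{T \<in> ?D. content_exp n lam' T = content_exp n lam L.row_tableau} \<noteq> {}"
      using fin fibres[of "content_exp n lam L.row_tableau"] by (metis card_eq_0_iff)
    then obtain T where T: "T \<in> ?D" "content_exp n lam' T = content_exp n lam L.row_tableau"
      by blast
    have "(\<Sum>i = 1..k. lam i) = L.tab_count L.row_tableau {1..k}"
      using L.tab_count_row_tableau[OF k] by simp
    also have "\<dots> = L'.tab_count T {1..k}"
      unfolding L.tab_count_content[OF finite_atLeastAtMost]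
        L'.tab_count_content[OF finite_atLeastAtMost]
      using T(2) lookup_content_exp[of _ n] k
      by (intro sum.cong refl) (metis atLeastAtMost_iff order_trans)
    also have "\<dots> \<le> (\<Sum>i = 1..card {1..k}. lam' i)"
      using T(1) k by (intro L'.tab_count_le) (auto simp: demazure_set_def)
    finally show "(\<Sum>i = 1..k. lam i) \<le> (\<Sum>i = 1..k. lam' i)" by simp
  next
    let ?Y = "key_tableau n lam' \<pi>"
    have "?Y \<in> ?D"
      using L'.key_in_tableaux[OF \<pi>] L'.scanning_key_le[OF \<pi>] by (simp add: demazure_set_def)
    then have "{T \<in> ?D. content_exp n lam' T = content_exp n lam' ?Y} \<noteq> {}" by blast
    then have "{T \<in> ?S. content_exp n lam T = content_exp n lam' ?Y} \<noteq> {}"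
      using fin fibres[of "content_exp n lam' ?Y"] by (metis card_eq_0_iff)
    then obtain T where T: "T \<in> ?S" "content_exp n lam T = content_exp n lam' ?Y"
      by blast
    have sub: "\<pi> ` {1..k} \<subseteq> {1..n}" by (rule L.perm_image_subset[OF \<pi> k])
    have "(\<Sum>i = 1..k. lam' i) = L'.tab_count ?Y (\<pi> ` {1..k})"
      using L'.tab_count_key[OF \<pi> k] by simp
    also have "\<dots> = L.tab_count T (\<pi> ` {1..k})"
      unfolding L.tab_count_content[OF finite_imageI[OF finite_atLeastAtMost]]
        L'.tab_count_content[OF finite_imageI[OF finite_atLeastAtMost]]
      using T(2) lookup_content_exp[of _ n] sub
      by (intro sum.cong refl) (metis subsetD)
    also have "\<dots> \<le> (\<Sum>i = 1..card (\<pi> ` {1..k}). lam i)"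
      using T(1) sub by (intro L.tab_count_le) (auto simp: row_bound_set_def)
    finally show "(\<Sum>i = 1..k. lam' i) \<le> (\<Sum>i = 1..k. lam i)"
      using L.card_perm_image[OF \<pi>, of "{1..k}"] by simp
  qed
  \<comment> \<open>Each part is the difference of two consecutive partial sums.\<close>
  have "lam i = lam' i" if "i \<in> {1..n}" for i
    using that sums[of i] sums[of "i - 1"] by (cases i) auto
  then have lam_eq: "lam = lam'"
    using assms(2,3) by (intro extensionalityI[of _ "{1..n}"]) (auto simp: partitions_def PiE_def)
  note coincidence =
    L.row_bound_demazure_coincidence[OF \<beta> \<pi> fibres[folded lam_eq], folded lam_eq]
  then have gapless: "core n lam \<beta> \<in> gapless_tuples n lam"
    using L.Psi_gapless[OF \<pi>] by simp
  note flag = L.Phi_flag[OF gapless] and Phi = L.row_bound_set_Phi[OF gapless \<beta> refl]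
  have "row_bound_sum n lam \<beta> = row_bound_sum n lam (Phi n lam (core n lam \<beta>))"
    using Phi by (simp add: row_bound_sum_def)
  then have "row_bound_sum n lam \<beta> \<in> flag_schur_polys n lam"
    unfolding flag_schur_polys_def using flag by (rule image_eqI)
  then show ?thesis
    using coincidence gapless flag Phi lam_eq \<beta> by (simp add: UGC_def)
qed

end
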